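(* Let $\mathbb F$ be a division ring with center $Z_{\mathbb F}$. Let $\Lambda=\{\alpha_1,\ldots,\alpha_n\}\subset\mathbb F$ (distinct elements) be left $P$-independent with every $\alpha_i$ algebraic over $Z_{\mathbb F}$, let $\Omega=\{\beta_1,\ldots,\beta_k\}\subset\mathbb F$ (distinct elements) be right $P$-independent, and let $c_1,\ldots,c_n,d_1,\ldots,d_k\in\mathbb F$. There exists a polynomial $f\in\mathbb F[z]$ such that $$f^{\mathfrak e_\ell}(\alpha_i)=c_i\ (i=1,\ldots,n),\qquad f^{\mathfrak e_r}(\beta_j)=d_j\ (j=1,\ldots,k)\qquad ( * )$$ if and only if $$\big((L_{\alpha_i}\mathcal X_{[\alpha_i]})\,c_i\big)^{\mathfrak e_r}(\beta_j)=\big((L_{\alpha_i}\mathcal X_{[\alpha_i]})\,d_j\big)^{\mathfrak e_r}(\beta_j)\quad\text{whenever }\alpha_i\sim\beta_j .$$ In this case, all $f\in P_{n+k}(\mathbb F)$ satisfying $( * )$ are given by the formula $$f(z)=\sum_{i=1}^n p_i(z)\,p_i^{\mathfrak e_\ell}(\alpha_i)^{-1}c_i+P_{\Lambda,\ell}(z)\cdot\sum_{i=1}^n\sum_{j=1}^k p_i^{\mathfrak e_\ell}(\alpha_i)^{-1}\,\Psi_{\alpha_i,\beta_j}(c_i-d_j)\,q_j^{\mathfrak e_r}(\beta_j)^{-1}q_j(z)+P_{\Lambda,\ell}(z)\cdot\sum_{\alpha_i\sim\beta_j}p_i^{\mathfrak e_\ell}(\alpha_i)^{-1}\varphi_{ij}\,q_j^{\mathfrak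 e_r}(\beta_j)^{-1}q_j(z),$$ where $p_i=P_{\Lambda\setminus\{\alpha_i\},\ell}$, $q_j=P_{\Omega\setminus\{\beta_j\},r}$, the last sum is over all pairs $(i,j)$ with $\alpha_i\sim\beta_j$, and where, for each such pair, $\varphi_{ij}\in\mathbb F$ is any intertwiner of $\alpha_i$ and $\beta_j$, i.e. any element with $\alpha_i\varphi_{ij}=\varphi_{ij}\beta_j$.
   Context: $\mathbb F[z]$ is the ring of polynomials in a variable $z$ commuting with the coefficients from $\mathbb F$; $P_N(\mathbb F)=\{g\in\mathbb F[z]:\deg g<N\}$ (including $0$). For $\alpha\in\mathbb F$, $[\alpha]=\{h\alpha h^{-1}:h\in\mathbb F\setminus\{0\}\}$, and $\alpha\sim\beta$ means $\beta\in[\alpha]$. Evaluations: for $f(z)=\sum_{j=0}^m z^jf_j$, $f^{\mathfrak e_\ell}(\alpha)=\sum_j\alpha^jf_j$ (left value) and $f^{\mathfrak e_r}(\alpha)=\sum_j f_j\alpha^j$ (right value). If all coefficients are in $Z_{\mathbb F}$ the two values agree and are written $f(\alpha)$. $L_\alpha f$ is the unique polynomial with $f(z)=f^{\mathfrak e_\ell}(\alpha)+(z-\alpha)\cdot(L_\alpha f)(z)$. Minimal polynomials: for a finite $\Delta\subset\mathbb F$, $P_{\Delta,\ell}$ is the monic generator of the right ideal $\{f\in\mathbb F[z]: f^{\mathfrak e_\ell}(\delta)=0\ \forall\delta\in\Delta\}$, and $P_{\Delta,r}$ is the monic generator of the left ideal $\{f\in\mathbb F[z]: f^{\mathfrak e_r}(\delta)=0\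 \forall\delta\in\Delta\}$ ($P_{\varnothing,\ell}=P_{\varnothing,r}=1$). $\Delta$ is left (right) $P$-independent if $\deg P_{\Delta,\ell}=|\Delta|$ (respectively $\deg P_{\Delta,r}=|\Delta|$). For $\alpha$ algebraic over $Z_{\mathbb F}$, $\mathcal X_{[\alpha]}\in Z_{\mathbb F}[z]$ is the (monic) minimal polynomial of $\alpha$ over $Z_{\mathbb F}$; it depends only on $[\alpha]$ and its zero set in $\mathbb F$ is $[\alpha]$. For $\alpha$ algebraic over $Z_{\mathbb F}$, $\kappa=\deg\mathcal X_{[\alpha]}$, and $\beta,\gamma\in\mathbb F$, the element $\Psi_{\alpha,\beta}(\gamma)$ is defined as follows: if $\beta\notin[\alpha]$, $$\Psi_{\alpha,\beta}(\gamma)=-\big((L_\alpha\mathcal X_{[\alpha]})\gamma\big)^{\mathfrak e_r}(\beta)\cdot\mathcal X_{[\alpha]}(\beta)^{-1};$$ if $\beta\in[\alpha]$, $$\Psi_{\alpha,\beta}(\gamma)=\sum_{j=1}^{\kappa-1}\sum_{i=0}^{j-1}\frac{(-1)^{i+j}}{(j+1)!}\binom{j-1}{i}\alpha^i\gamma\,\mathcal X_{[\alpha]}^{(j+1)}(\beta)\,\beta^{j-i-1}\cdot\mathcal X_{[\alpha]}'(\beta)^{-1},$$ where derivatives are formal derivatives.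
   Formalization: The formula for all f in P_{n+k} is stated only when, for each pair α_i ~ β_j, (deg X_{[α_i]})! is nonzero in F (otherwise 1/(j+1)! in Ψ is undefined); n ≥ 1 is assumed throughout (for n = 0, k = 1, d_1 = 1 the formula would give f = 0). *)

theory Defs
  imports "HOL-Library.Poly_Mapping"
begin

text \<open>
  The library type \<open>'a poly\<close> has a product only over commutative coefficients.  Polynomials
  over a division ring are therefore elements of the monoid ring \<open>nat \<Rightarrow>\<^sub>0 'a\<close> of
  \<^theory>\<open>HOL-Library.Poly_Mapping\<close>, whose convolution product makes the variable commute
  with all coefficients.
\<close>

type_synonym 'a zpoly = "nat \<Rightarrow>\<^sub>0 'a"

abbreviation coef :: "'a::zero zpoly \<Rightarrow> nat \<Rightarrow> 'a" where
  "coef \<equiv> Poly_Mapping.lookup"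

abbreviation cnst :: "'a::zero \<Rightarrow> 'a zpoly" where
  "cnst a \<equiv> Poly_Mapping.single 0 a"

abbreviation zvar :: "'a::{zero,one} zpoly" where
  "zvar \<equiv> Poly_Mapping.single 1 1"

text \<open>
  \<open>Poly_Mapping.degree\<close> is one more than the usual degree of a nonzero polynomial.
  As usual in HOL, \<open>zdeg 0 = 0\<close>.
\<close>

definition zdeg :: "'a::zero zpoly \<Rightarrow> nat" where
  "zdeg f = Poly_Mapping.degree f - 1"

definition monic :: "'a::{zero,one} zpoly \<Rightarrow> bool" where
  "monic f \<longleftrightarrow> coef f (zdeg f) = 1"

definition polys_below :: "nat \<Rightarrow> 'a::zero zpoly set" where
  "polys_below N = {g. g = 0 \<or> zdeg g < N}"

definition formal_deriv :: "'a::ring_1 zpoly \<Rightarrow> 'a zpoly" where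
  "formal_deriv f =
     (\<Sum>m\<in>Poly_Mapping.keys f. Poly_Mapping.single (m - 1) (of_nat m * coef f m))"

definition lval :: "'a::ring_1 zpoly \<Rightarrow> 'a \<Rightarrow> 'a" where
  "lval f a = (\<Sum>m\<in>Poly_Mapping.keys f. a ^ m * coef f m)"

definition rval :: "'a::ring_1 zpoly \<Rightarrow> 'a \<Rightarrow> 'a" where
  "rval f a = (\<Sum>m\<in>Poly_Mapping.keys f. coef f m * a ^ m)"

definition Lquot :: "'a::ring_1 \<Rightarrow> 'a zpoly \<Rightarrow> 'a zpoly" where
  "Lquot a f = (THE g. f = cnst (lval f a) + (zvar - cnst a) * g)"

definition ring_center :: "'a::ring_1 set" where
  "ring_center = {a. \<forall>b. a * b = b * a}"

definition central_poly :: "'a::ring_1 zpoly \<Rightarrow> bool" where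
  "central_poly f \<longleftrightarrow> (\<forall>m. coef f m \<in> ring_center)"

definition conj_class :: "'a::division_ring \<Rightarrow> 'a set" where
  "conj_class a = {h * a * inverse h | h. h \<noteq> 0}"

definition conjugate :: "'a::division_ring \<Rightarrow> 'a \<Rightarrow> bool" where
  "conjugate a b \<longleftrightarrow> b \<in> conj_class a"

definition algebraic_over_center :: "'a::division_ring \<Rightarrow> bool" where
  "algebraic_over_center a \<longleftrightarrow> (\<exists>f. f \<noteq> 0 \<and> central_poly f \<and> lval f a = 0)"

text \<open>
  Minimal polynomial over the center; meaningful only for \<open>a\<close> algebraic over the center.
\<close>

definition center_minpoly :: "'a::division_ring \<Rightarrow> 'a zpoly" where
  "center_minpoly a = (THE f. central_poly f \<and> monic f \<and> lval f a = 0 \<and>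
     (\<forall>g. central_poly g \<and> g \<noteq> 0 \<and> lval g a = 0 \<longrightarrow> zdeg f \<le> zdeg g))"

definition left_minpoly :: "'a::division_ring set \<Rightarrow> 'a zpoly" where
  "left_minpoly D =
     (THE p. monic p \<and> {f. \<forall>x\<in>D. lval f x = 0} = {p * g | g. True})"

definition right_minpoly :: "'a::division_ring set \<Rightarrow> 'a zpoly" where
  "right_minpoly D =
     (THE p. monic p \<and> {f. \<forall>x\<in>D. rval f x = 0} = {g * p | g. True})"

definition left_P_independent :: "'a::division_ring set \<Rightarrow> bool" where
  "left_P_independent D \<longleftrightarrow> finite D \<and> zdeg (left_minpoly D) = card D"

definition right_P_independent :: "'a::division_ring set \<Rightarrow> bool" where
  "right_P_independent D \<longleftrightarrow> finite D \<and> zdeg (right_minpoly D) = card D"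

text \<open>
  Central polynomials are evaluated with \<^const>\<open>lval\<close>; left and right values agree for them.
  The quotient \<open>1 / (j + 1)!\<close> is taken in the division ring, so for conjugate \<open>a\<close> and \<open>b\<close>
  the formula is meaningful only if \<open>fact (zdeg (center_minpoly a))\<close> is nonzero there.  The
  derivative of the minimal polynomial then does not vanish at \<open>b\<close>: it is a nonzero central
  polynomial of smaller degree.
\<close>

definition Psi :: "'a::division_ring \<Rightarrow> 'a \<Rightarrow> 'a \<Rightarrow> 'a" where
  "Psi a b c =
     (let X = center_minpoly a in
      if conjugate a b then
        (\<Sum>j = 1..zdeg X - 1. \<Sum>i = 0..j - 1.
           ((- 1) ^ (i + j) / of_nat (fact (j + 1))) * of_nat ((j - 1) choose i)
           * a ^ i * c * lval ((formal_deriv ^^ (j + 1)) X) b * b ^ (j - i - 1)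
           * inverse (lval (formal_deriv X) b))
      else
        - rval (Lquot a X * cnst c) b * inverse (lval X b))"

end

theory Submission
  imports Defs
begin

text \<open>
  Right evaluation at \<open>b\<close> sees only the right value of the last factor:
  \<open>rval (f * g) b = rval (f * cnst (rval g b)) b\<close> (\<open>right_value_times\<close>).  The polynomials with
  the prescribed left values are \<open>f\<^sub>0 + P * g\<close>, where \<open>f\<^sub>0\<close> is the Lagrange interpolant of the left
  data and \<open>P\<close> the left minimal polynomial of the left nodes, so the right condition at a node
  \<open>b\<close> with prescribed value \<open>d\<close> is a condition on the single element \<open>rval g b\<close>.  The elements
  \<open>rval g b\<close>, for \<open>b\<close> in the set of \<open>k\<close> right nodes, are arbitrary and determine \<open>g\<close> when
  \<open>deg g < k\<close>.  Hence each right node can be treated on its own.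

  For a fixed \<open>b\<close> the map \<open>x \<mapsto> rval (P * cnst x) b\<close> is understood through the factorizations
  \<open>P = p\<^sub>a * (z - u\<^sub>a a u\<^sub>a\<^sup>-\<^sup>1)\<close>, where \<open>p\<^sub>a\<close> is the minimal polynomial of the other
  nodes and \<open>u\<^sub>a\<close> the inverse of its left value at \<open>a\<close>: the map sends \<open>u\<^sub>a x\<close> to the right value
  of \<open>p\<^sub>a * cnst (u\<^sub>a (x b - a x))\<close>.  As the polynomials \<open>p\<^sub>a u\<^sub>a\<close> add up to \<open>1\<close>, a particular solution
  is \<open>\<Sum> u\<^sub>a x\<^sub>a\<close> with \<open>a x\<^sub>a - x\<^sub>a b = c\<^sub>a - d\<close> (\<open>minpoly_action_particular\<close>), and its
  kernel consists of the sums \<open>\<Sum> u\<^sub>a \<phi>\<^sub>a\<close> with \<open>a \<phi>\<^sub>a = \<phi>\<^sub>a b\<close>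
  (\<open>minpoly_action_kernel\<close>).

  What remains is the equation \<open>a x - x b = c\<close> for \<open>a\<close> algebraic over the center, with minimal
  polynomial \<open>X = (z - a) L\<close>.  Centrality of \<open>X\<close> gives
  \<open>y b - a y = c X(b)\<close> for \<open>y = rval (L * cnst c) b\<close>.  If \<open>b\<close> is not conjugate to \<open>a\<close>, then
  \<open>X(b)\<close> is invertible and the equation is solved by \<open>- y X(b)\<^sup>-\<^sup>1\<close>.  If \<open>b\<close> is conjugate to \<open>a\<close>, then
  \<open>y = 0\<close> is necessary, and it is also sufficient, in every characteristic, because
  \<open>cnst w * L = 1 + (z - a) * G\<close> for some \<open>w\<close> and \<open>G\<close> (\<open>sylvester_conjugate\<close>).  If moreover
  \<open>(deg X)!\<close> does not vanish, the Taylor expansion of \<open>X\<close> at \<open>b\<close> in powers of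
  \<open>x \<mapsto> a x - x b\<close> has the invertible coefficient \<open>X'(b)\<close> in degree one, and solving
  it for \<open>c\<close> yields the explicit solution \<open>Psi\<close> (\<open>sylvester_Psi_conjugate\<close>).
\<close>

section \<open>Coefficients and degrees\<close>

lemma zpoly_induct [case_names single add]:
  fixes f :: "'a::ring_1 zpoly"
  assumes single: "\<And>m c. Q (Poly_Mapping.single m c)"
    and add: "\<And>f g. Q f \<Longrightarrow> Q g \<Longrightarrow> Q (f + g)"
  shows "Q f"
proof (induction f rule: update_induct)
  case const
  show ?case using single[of 0 0] by simp
next
  case (update f a b)
  have "Poly_Mapping.update a b f = f + Poly_Mapping.single a b"
    using update(1)
    by (intro poly_mapping_eqI)
       (auto simp: lookup_update lookup_add lookup_single not_in_keys_iff_lookup_eq_zero when_def)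
  then show ?case using update single add by simp
qed

lemma coef_times:
  fixes f g :: "'a::ring_1 zpoly"
  shows "coef (f * g) m = (\<Sum>i\<le>m. coef f i * coef g (m - i))"
proof (induction f rule: zpoly_induct)
  case (single i a)
  show ?case
  proof (induction g rule: zpoly_induct)
    case (single j b)
    have "(\<Sum>l\<le>m. coef (Poly_Mapping.single i a) l * coef (Poly_Mapping.single j b) (m - l))
        = (\<Sum>l\<le>m. if l = i then a * (b when j = m - i) else 0)"
      by (rule sum.cong) (auto simp: lookup_single when_def)
    also have "\<dots> = (a * b when i + j = m)"
      by (auto simp: when_def)
    finally show ?case by (simp add: mult_single lookup_single)
  qed (simp add: distrib_left lookup_add sum.distrib)
qed (simp add: distrib_right lookup_add sum.distrib)

lemma coef_cnst_times [simp]: "coef (cnst c * f) m = c * coef f m" for c :: "'a::ring_1"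
  by (simp add: coef_times lookup_single when_def if_distrib[of "\<lambda>x. x * _"] cong: if_cong)

lemma coef_times_cnst [simp]: "coef (f * cnst c) m = coef f m * c" for c :: "'a::ring_1"
proof -
  have "coef (f * cnst c) m = (\<Sum>i\<le>m. if i = m then coef f m * c else 0)"
    unfolding coef_times by (rule sum.cong) (auto simp: lookup_single when_def)
  then show ?thesis by simp
qed

lemma cnst_sum: "cnst (\<Sum>i\<in>I. g i) = (\<Sum>i\<in>I. cnst (g i))"
  for g :: "'b \<Rightarrow> 'a::ring_1"
  by (induction I rule: infinite_finite_induct) (simp_all add: single_add)

lemma polys_below_iff: "f \<in> polys_below N \<longleftrightarrow> (\<forall>m\<ge>N. coef f m = 0)"
proof -
  have "Poly_Mapping.degree f \<le> N \<longleftrightarrow> (\<forall>m\<ge>N. coef f m = 0)"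
  proof (cases "f = 0")
    case False
    then have "0 < Poly_Mapping.degree f"
      using degree_zero_iff by (metis gr0I)
    then have "Poly_Mapping.degree f - 1 \<in> Poly_Mapping.keys f"
      by (rule degree_greater_zero_in_keys)
    then have "coef f (Poly_Mapping.degree f - 1) \<noteq> 0"
      by (simp add: in_keys_iff)
    then show ?thesis
      using beyond_degree_lookup_zero[of f] \<open>0 < _\<close>
      by (metis Suc_pred' le_trans not_less_eq_eq)
  qed simp
  moreover have "f \<in> polys_below N \<longleftrightarrow> Poly_Mapping.degree f \<le> N"
  proof (cases "f = 0")
    case False
    then have "Poly_Mapping.degree f \<noteq> 0" by simp
    then have "Poly_Mapping.degree f - 1 < N \<longleftrightarrow> Poly_Mapping.degree f \<le> N" by linarith
    with False show ?thesis by (simp add: polys_below_def zdeg_def)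
  qed (simp add: polys_below_def)
  ultimately show ?thesis by simp
qed

lemma polys_below_self: "f \<in> polys_below (Suc (zdeg f))"
  by (simp add: polys_below_def)

lemma lead_coef_nonzero: "f \<noteq> 0 \<Longrightarrow> coef f (zdeg f) \<noteq> 0"
proof -
  assume "f \<noteq> 0"
  then have "0 < Poly_Mapping.degree f"
    using degree_zero_iff by (metis gr0I)
  then show ?thesis
    using degree_greater_zero_in_keys by (auto simp: zdeg_def in_keys_iff)
qed

lemma zdeg_eqI: "f \<in> polys_below (Suc m) \<Longrightarrow> coef f m \<noteq> 0 \<Longrightarrow> zdeg f = m"
  by (metis (no_types, opaque_lifting) polys_below_iff polys_below_self lead_coef_nonzero
    lookup_zero not_less_eq_eq le_antisym linorder_not_le)

lemma polys_below_mono: "f \<in> polys_below M \<Longrightarrow> M \<le> N \<Longrightarrow> f \<in> polys_below N"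
  by (auto simp: polys_below_iff)

lemma polys_below_add: "f \<in> polys_below N \<Longrightarrow> g \<in> polys_below N \<Longrightarrow> f + g \<in> polys_below N"
  for f :: "'a::ring_1 zpoly"
  by (simp add: polys_below_iff lookup_add)

lemma polys_below_diff: "f \<in> polys_below N \<Longrightarrow> g \<in> polys_below N \<Longrightarrow> f - g \<in> polys_below N"
  for f :: "'a::ring_1 zpoly"
  by (simp add: polys_below_iff lookup_minus)

lemma polys_below_sum: "(\<And>i. i \<in> I \<Longrightarrow> f i \<in> polys_below N) \<Longrightarrow> (\<Sum>i\<in>I. f i) \<in> polys_below N"
  for f :: "'b \<Rightarrow> 'a::ring_1 zpoly"
  by (simp add: polys_below_iff lookup_sum)

lemma polys_below_times:
  fixes f g :: "'a::ring_1 zpoly"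
  assumes "f \<in> polys_below (Suc a)" "g \<in> polys_below b"
  shows "f * g \<in> polys_below (a + b)"
  unfolding polys_below_iff coef_times
proof (intro allI impI sum.neutral ballI)
  fix m i assume "a + b \<le> m" "i \<in> {..m}"
  show "coef f i * coef g (m - i) = 0"
  proof (cases "i \<le> a")
    case True
    then have "b \<le> m - i" using \<open>a + b \<le> m\<close> by simp
    then show ?thesis using assms by (simp add: polys_below_iff)
  next
    case False
    then show ?thesis using assms by (simp add: polys_below_iff)
  qed
qed

lemma lead_coef_times:
  fixes f g :: "'a::ring_1 zpoly"
  assumes "f \<in> polys_below (Suc a)" "g \<in> polys_below (Suc b)"
  shows "coef (f * g) (a + b) = coef f a * coef g b"
proof -
  have "coef (f * g) (a + b) = (\<Sum>i\<le>a + b. if i = a then coef f a * coef g b else 0)"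
    unfolding coef_times
  proof (rule sum.cong)
    fix i assume "i \<in> {..a + b}"
    then show "coef f i * coef g (a + b - i) = (if i = a then coef f a * coef g b else 0)"
      using assms
      by (cases "i < a") (auto simp: polys_below_iff)
  qed simp
  then show ?thesis by simp
qed

lemma zdeg_times:
  fixes f g :: "'a::division_ring zpoly"
  assumes "f \<noteq> 0" "g \<noteq> 0"
  shows "zdeg (f * g) = zdeg f + zdeg g"
proof (rule zdeg_eqI)
  show "f * g \<in> polys_below (Suc (zdeg f + zdeg g))"
    using polys_below_times[OF polys_below_self polys_below_self] by simp
  show "coef (f * g) (zdeg f + zdeg g) \<noteq> 0"
    using assms by (simp add: lead_coef_times[OF polys_below_self polys_below_self] lead_coef_nonzero)
qed

lemma monic_nonzero: "monic f \<Longrightarrow> f \<noteq> 0" for f :: "'a::division_ring zpoly"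
  by (auto simp: monic_def)

lemma monic_times: "monic f \<Longrightarrow> monic g \<Longrightarrow> monic (f * g)" for f :: "'a::division_ring zpoly"
  by (simp add: monic_def zdeg_times monic_nonzero[unfolded monic_def]
      lead_coef_times[OF polys_below_self polys_below_self])

lemma zdeg_cnst [simp]: "zdeg (cnst c) = 0"
  by (cases "c = 0") (simp_all add: zdeg_def)

lemma monic_one: "monic (1 :: 'a::division_ring zpoly)" 
  by (simp add: monic_def zdeg_def)

lemma zdeg_one [simp]: "zdeg (1 :: 'a::division_ring zpoly) = 0"
  by (simp add: zdeg_def)

definition linear_factor :: "'a::ring_1 \<Rightarrow> 'a zpoly" where
  "linear_factor a = zvar - cnst a"

lemma coef_linear: "coef (linear_factor a) m = (if m = 1 then 1 else if m = 0 then - a else 0)"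
  for a :: "'a::ring_1"
  by (auto simp: linear_factor_def lookup_minus lookup_single when_def)

lemma linear_polys_below: "linear_factor a \<in> polys_below (Suc 1)"
  for a :: "'a::ring_1"
  by (simp add: polys_below_iff coef_linear)

lemma zdeg_linear [simp]: "zdeg (linear_factor a) = 1"
  for a :: "'a::ring_1"
  by (rule zdeg_eqI[OF linear_polys_below]) (simp add: coef_linear)

lemma linear_neq_0 [simp]: "linear_factor a \<noteq> 0"
  for a :: "'a::ring_1"
  by (metis zdeg_linear coef_linear lookup_zero zero_neq_one)

lemma monic_linear: "monic (linear_factor a)"
  for a :: "'a::ring_1"
  by (simp add: monic_def coef_linear)

lemma monic_diff_polys_below:
  fixes f g :: "'a::ring_1 zpoly"
  assumes "monic f" "monic g" "zdeg f = zdeg g"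
  shows "f - g \<in> polys_below (zdeg f)"
  unfolding polys_below_iff lookup_minus
  using assms polys_below_self[of f] polys_below_self[of g]
  by (metis polys_below_iff cancel_comm_monoid_add_class.diff_cancel monic_def not_less_eq_eq le_antisym)

section \<open>Left and right values\<close>

lemma lval_supset:
  "finite S \<Longrightarrow> Poly_Mapping.keys f \<subseteq> S \<Longrightarrow> lval f a = (\<Sum>m\<in>S. a ^ m * coef f m)"
  unfolding lval_def by (rule sum.mono_neutral_left) (auto simp: in_keys_iff)

lemma rval_supset:
  "finite S \<Longrightarrow> Poly_Mapping.keys f \<subseteq> S \<Longrightarrow> rval f a = (\<Sum>m\<in>S. coef f m * a ^ m)"
  unfolding rval_def by (rule sum.mono_neutral_left) (auto simp: in_keys_iff)

lemma lval_add: "lval (f + g) a = lval f a + lval g a"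
proof -
  let ?S = "Poly_Mapping.keys f \<union> Poly_Mapping.keys g"
  show ?thesis
    using lval_supset[of ?S "f + g" a] lval_supset[of ?S f a] lval_supset[of ?S g a]
    by (simp add: keys_add lookup_add distrib_left sum.distrib)
qed

lemma rval_add: "rval (f + g) a = rval f a + rval g a"
proof -
  let ?S = "Poly_Mapping.keys f \<union> Poly_Mapping.keys g"
  show ?thesis
    using rval_supset[of ?S "f + g" a] rval_supset[of ?S f a] rval_supset[of ?S g a]
    by (simp add: keys_add lookup_add distrib_right sum.distrib)
qed

lemma lval_single [simp]: "lval (Poly_Mapping.single m c) a = a ^ m * c"
  by (simp add: lval_def)

lemma rval_single [simp]: "rval (Poly_Mapping.single m c) a = c * a ^ m"
  by (simp add: rval_def)

lemma lval_zero [simp]: "lval 0 a = 0" and rval_zero [simp]: "rval 0 a = 0"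
  by (simp_all add: lval_def rval_def)

lemma rval_one [simp]: "rval 1 a = 1"
  by (simp add: rval_def)

lemma lval_diff: "lval (f - g) a = lval f a - lval g a"
  using lval_add[of "f - g" g a] by simp

lemma rval_diff: "rval (f - g) a = rval f a - rval g a"
  using rval_add[of "f - g" g a] by simp

lemma rval_sum: "rval (\<Sum>i\<in>I. f i) a = (\<Sum>i\<in>I. rval (f i) a)"
  by (induction I rule: infinite_finite_induct) (simp_all add: rval_add)

lemma lval_times_cnst [simp]: "lval (f * cnst c) a = lval f a * c"
  by (induction f rule: zpoly_induct) (simp_all add: mult_single distrib_right lval_add mult.assoc)

lemma rval_cnst_times [simp]: "rval (cnst c * f) a = c * rval f a"
  by (induction f rule: zpoly_induct) (simp_all add: mult_single distrib_left rval_add mult.assoc)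

lemma lval_linear_times [simp]: "lval (linear_factor a * g) a = 0"
  by (induction g rule: zpoly_induct)
     (simp_all add: linear_factor_def left_diff_distrib distrib_left mult_single lval_add lval_diff
       mult.assoc power_commutes flip: mult.assoc)

lemma rval_times_linear [simp]: "rval (g * linear_factor a) a = 0"
  by (induction g rule: zpoly_induct)
     (simp_all add: linear_factor_def right_diff_distrib distrib_right mult_single rval_add rval_diff mult.assoc)

text \<open>
  For a monomial this is \<open>z\<^sup>m\<^sup>+\<^sup>1 c = z\<^sup>m (a c) + (z - a) z\<^sup>m c\<close>, which reduces the exponent at the
  price of another coefficient.
\<close>

lemma left_remainder: "\<exists>g. f = cnst (lval f a) + linear_factor a * g"
proof (induction f rule: zpoly_induct)
  case (single m c)
  show ?case
  proof (induction m arbitrary: c)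
    case 0
    show ?case by (intro exI[of _ 0]) simp
  next
    case (Suc m)
    obtain g where g: "Poly_Mapping.single m (a * c) = cnst (a ^ m * (a * c)) + linear_factor a * g"
      using Suc[of "a * c"] by auto
    have "Poly_Mapping.single (Suc m) c
        = Poly_Mapping.single m (a * c) + linear_factor a * Poly_Mapping.single m c"
      by (simp add: linear_factor_def left_diff_distrib mult_single)
    also have "\<dots> = cnst (lval (Poly_Mapping.single (Suc m) c) a)
        + linear_factor a * (g + Poly_Mapping.single m c)"
      by (subst g) (simp add: distrib_left power_Suc2 mult.assoc del: power_Suc)
    finally show ?case by blast
  qed
next
  case (add f g)
  then obtain s t where s: "f = cnst (lval f a) + linear_factor a * s"
      and t: "g = cnst (lval g a) + linear_factor a * t" by blast
  have "f + g = (cnst (lval f a) + linear_factor a * s) + (cnst (lval g a) + linear_factor a * t)"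
    by (rule arg_cong2[where f = "(+)", OF s t])
  also have "\<dots> = cnst (lval (f + g) a) + linear_factor a * (s + t)"
    by (simp add: lval_add single_add distrib_left)
  finally have "f + g = cnst (lval (f + g) a) + linear_factor a * (s + t)" .
  then show ?case by blast
qed

lemma right_remainder: "\<exists>g. f = cnst (rval f a) + g * linear_factor a"
proof (induction f rule: zpoly_induct)
  case (single m c)
  show ?case
  proof (induction m arbitrary: c)
    case 0
    show ?case by (intro exI[of _ 0]) simp
  next
    case (Suc m)
    obtain g where g: "Poly_Mapping.single m (c * a) = cnst (c * a * a ^ m) + g * linear_factor a"
      using Suc[of "c * a"] by auto
    have "Poly_Mapping.single (Suc m) c
        = Poly_Mapping.single m (c * a) + Poly_Mapping.single m c * linear_factor a"
      by (simp add: linear_factor_def right_diff_distrib mult_single)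
    also have "\<dots> = cnst (rval (Poly_Mapping.single (Suc m) c) a)
        + (g + Poly_Mapping.single m c) * linear_factor a"
      by (subst g) (simp add: distrib_right mult.assoc)
    finally show ?case by blast
  qed
next
  case (add f g)
  then obtain s t where s: "f = cnst (rval f a) + s * linear_factor a"
      and t: "g = cnst (rval g a) + t * linear_factor a" by blast
  have "f + g = (cnst (rval f a) + s * linear_factor a) + (cnst (rval g a) + t * linear_factor a)"
    by (rule arg_cong2[where f = "(+)", OF s t])
  also have "\<dots> = cnst (rval (f + g) a) + (s + t) * linear_factor a"
    by (simp add: rval_add single_add distrib_right)
  finally have "f + g = cnst (rval (f + g) a) + (s + t) * linear_factor a" .
  then show ?case by blast
qed

lemma lval_eq_0_iff: "lval f a = 0 \<longleftrightarrow> (\<exists>g. f = linear_factor a * g)"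
  using left_remainder[of f a] by (metis add_0 lval_linear_times single_zero)

lemma rval_eq_0_iff: "rval f a = 0 \<longleftrightarrow> (\<exists>g. f = g * linear_factor a)"
  using right_remainder[of f a] by (metis add_0 rval_times_linear single_zero)

text \<open>
  With \<open>g = rval g b + h (z - b)\<close> the summand \<open>f h (z - b)\<close> vanishes at \<open>b\<close>.  Right values at \<open>b\<close>
  thus turn the coefficient ring into a left module over the polynomials, on which \<open>z\<close> acts as
  right multiplication by \<open>b\<close>.
\<close>

lemma right_value_times: "rval (f * g) b = rval (f * cnst (rval g b)) b"
proof -
  obtain h where h: "g = cnst (rval g b) + h * linear_factor b"
    using right_remainder by blast
  have "rval (f * g) b = rval (f * cnst (rval g b) + (f * h) * linear_factor b) b"
    by (subst h) (simp add: distrib_left mult.assoc)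
  then show ?thesis by (simp only: rval_add rval_times_linear add_0_right)
qed

lemma left_value_times: "lval (f * g) a = lval (cnst (lval f a) * g) a"
proof -
  obtain h where h: "f = cnst (lval f a) + linear_factor a * h"
    using left_remainder by blast
  have "lval (f * g) a = lval (cnst (lval f a) * g + linear_factor a * (h * g)) a"
    by (subst h) (simp add: distrib_right mult.assoc)
  then show ?thesis by (simp only: lval_add lval_linear_times add_0_right)
qed

lemma conjugate_power:
  fixes v a :: "'a::division_ring"
  assumes "v \<noteq> 0"
  shows "v * (inverse v * a * v) ^ m = a ^ m * v" "(v * a * inverse v) ^ m * v = v * a ^ m"
proof -
  show "v * (inverse v * a * v) ^ m = a ^ m * v"
  proof (induction m)
    case (Suc m)
    have "v * (inverse v * a * v) ^ Suc m = (v * inverse v) * a * (v * (inverse v * a * v) ^ m)"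
      by (simp add: mult.assoc)
    also have "\<dots> = a ^ Suc m * v" using assms Suc by (simp add: mult.assoc)
    finally show ?case .
  qed simp
  show "(v * a * inverse v) ^ m * v = v * a ^ m"
  proof (induction m)
    case (Suc m)
    have "(v * a * inverse v) ^ Suc m * v = v * a * inverse v * ((v * a * inverse v) ^ m * v)"
      by (simp add: mult.assoc)
    also have "\<dots> = v * a * (inverse v * v) * a ^ m"
      unfolding Suc by (simp only: mult.assoc)
    also have "\<dots> = v * a ^ Suc m" using assms by (simp add: mult.assoc)
    finally show ?case .
  qed simp
qed

text \<open>
  The product formula of noncommutative evaluation: together with \<open>left_value_times\<close> it says that
  \<open>f * g\<close> takes at \<open>a\<close> the value of \<open>f\<close> times the value of \<open>g\<close> at a conjugate of \<open>a\<close>.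
\<close>

lemma lval_cnst_times:
  fixes v :: "'a::division_ring"
  assumes "v \<noteq> 0"
  shows "lval (cnst v * g) a = v * lval g (inverse v * a * v)"
proof (induction g rule: zpoly_induct)
  case (single m c)
  have "a ^ m * v * c = v * (inverse v * a * v) ^ m * c"
    using conjugate_power(1)[OF assms, of a m] by simp
  then show ?case by (simp add: mult_single mult.assoc)
qed (simp add: distrib_left lval_add)

lemma rval_times_cnst:
  fixes v :: "'a::division_ring"
  assumes "v \<noteq> 0"
  shows "rval (g * cnst v) b = rval g (v * b * inverse v) * v"
proof (induction g rule: zpoly_induct)
  case (single m c)
  have "c * (v * b ^ m) = c * ((v * b * inverse v) ^ m * v)"
    using conjugate_power(2)[OF assms, of b m] by simp
  then show ?case by (simp add: mult_single mult.assoc)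
qed (simp add: distrib_right rval_add)

section \<open>Minimal polynomials and Lagrange interpolation\<close>

text \<open>
  Left and right evaluation are mirror images of each other: reversing products exchanges them.
  The locale collects what the theory of minimal polynomials and Lagrange interpolation uses of
  either side.  If \<open>f\<close> has the value \<open>v \<noteq> 0\<close> at \<open>x\<close>, then \<open>conj v x\<close> is the conjugate of
  \<open>x\<close> at which \<open>g\<close> has to vanish for \<open>M f g\<close> to vanish at \<open>x\<close>, and \<open>quot v c\<close> is the
  constant factor that changes the value \<open>v\<close> into \<open>c\<close>.
\<close>

locale evaluation =
  fixes M :: "'a::division_ring zpoly \<Rightarrow> 'a zpoly \<Rightarrow> 'a zpoly"
    and E :: "'a zpoly \<Rightarrow> 'a \<Rightarrow> 'a"
    and conj :: "'a \<Rightarrow> 'a \<Rightarrow> 'a"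
    and quot :: "'a \<Rightarrow> 'a \<Rightarrow> 'a"
  assumes M_assoc: "M (M f g) h = M f (M g h)"
    and M_1_left: "M 1 f = f"
    and M_1_right: "M f 1 = f"
    and M_0_right: "M f 0 = 0"
    and zdeg_M: "f \<noteq> 0 \<Longrightarrow> g \<noteq> 0 \<Longrightarrow> M f g \<noteq> 0 \<and> zdeg (M f g) = zdeg f + zdeg g"
    and M_monic: "monic f \<Longrightarrow> monic g \<Longrightarrow> monic (M f g)"
    and M_cnst: "f \<in> polys_below N \<Longrightarrow> M f (cnst c) \<in> polys_below N"
    and E_0: "E 0 x = 0"
    and E_diff: "E (f - g) x = E f x - E g x"
    and E_add: "E (f + g) x = E f x + E g x"
    and E_eq_0_iff: "E f x = 0 \<longleftrightarrow> (\<exists>g. f = M (linear_factor x) g)"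
    and E_M_eq_0_iff: "E f x \<noteq> 0 \<Longrightarrow> E (M f g) x = 0 \<longleftrightarrow> E g (conj (E f x) x) = 0"
    and E_M_quot: "E f x \<noteq> 0 \<Longrightarrow> E (M f (cnst (quot (E f x) c))) x = c"
begin

definition vanishing :: "'a set \<Rightarrow> 'a zpoly set" where
  "vanishing D = {f. \<forall>x\<in>D. E f x = 0}"

definition minpoly :: "'a set \<Rightarrow> 'a zpoly" where
  "minpoly D = (THE p. monic p \<and> vanishing D = {M p g | g. True})"

lemma E_M_eq_0: "E f x = 0 \<Longrightarrow> E (M f g) x = 0"
  by (metis E_eq_0_iff M_assoc)

lemma E_sum: "E (\<Sum>i\<in>I. F i) x = (\<Sum>i\<in>I. E (F i) x)"
  by (induction I rule: infinite_finite_induct) (simp_all add: E_0 E_add)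

text \<open>
  A generator that does not yet vanish at \<open>x\<close> is extended by one linear factor, whose root is the
  conjugate of \<open>x\<close> dictated by the product formula.  This constructs minimal polynomials without
  division with remainder and bounds their degree by the number of nodes.
\<close>

lemma generator_insert:
  assumes "monic p" "vanishing D = {M p g | g. True}"
  shows "E p x = 0 \<Longrightarrow> vanishing (insert x D) = {M p g | g. True}"
    and "E p x \<noteq> 0 \<Longrightarrow>
      vanishing (insert x D) = {M (M p (linear_factor (conj (E p x) x))) g | g. True}"
proof -
  have ins: "vanishing (insert x D) = {f \<in> vanishing D. E f x = 0}"
    by (auto simp: vanishing_def)
  show "vanishing (insert x D) = {M p g | g. True}" if "E p x = 0"
    unfolding ins assms(2) using E_M_eq_0[OF that] by auto
  show "vanishing (insert x D) = {M (M p (linear_factor (conj (E p x) x))) g | g. True}"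
    if "E p x \<noteq> 0"
  proof -
    have "vanishing (insert x D) = {M p g | g. E g (conj (E p x) x) = 0}"
      unfolding ins assms(2) using E_M_eq_0_iff[OF that] by auto
    also have "\<dots> = {M p (M (linear_factor (conj (E p x) x)) h) | h. True}"
      unfolding E_eq_0_iff by blast
    finally show ?thesis by (simp only: M_assoc)
  qed
qed

lemma generator_exists:
  assumes "finite D"
  shows "\<exists>p. monic p \<and> vanishing D = {M p g | g. True} \<and> zdeg p \<le> card D"
  using assms
proof (induction D)
  case empty
  show ?case
    by (rule exI[of _ 1]) (auto simp: vanishing_def monic_one M_1_left)
next
  case (insert x D)
  then obtain p where p: "monic p" "vanishing D = {M p g | g. True}" "zdeg p \<le> card D"
    by blast
  show ?case
  proof (cases "E p x = 0")
    case True
    then show ?thesis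
      using p generator_insert(1)[OF p(1,2) True] insert by (intro exI[of _ p]) auto
  next
    case False
    let ?p = "M p (linear_factor (conj (E p x) x))"
    have "zdeg ?p = zdeg p + 1"
      using zdeg_M[OF monic_nonzero[OF p(1)] linear_neq_0] by simp
    then show ?thesis
      using p generator_insert(2)[OF p(1,2) False] insert
      by (intro exI[of _ ?p]) (auto simp: M_monic monic_linear)
  qed
qed

lemma generator_min:
  assumes "monic p" "vanishing D = {M p g | g. True}" "f \<in> vanishing D" "f \<in> polys_below (zdeg p)"
  shows "f = 0"
proof (rule ccontr)
  assume "f \<noteq> 0"
  obtain g where g: "f = M p g" using assms by auto
  show False
  proof (cases "g = 0")
    case True
    then show False using g \<open>f \<noteq> 0\<close> M_0_right by simp
  next
    case False
    then have "zdeg f = zdeg p + zdeg g"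
      using g zdeg_M[OF monic_nonzero[OF assms(1)] False] by simp
    then show False using assms(4) \<open>f \<noteq> 0\<close> by (simp add: polys_below_def)
  qed
qed

lemma generator_unique:
  assumes p: "monic p" "vanishing D = {M p g | g. True}"
    and q: "monic q" "vanishing D = {M q g | g. True}"
  shows "p = q"
proof -
  have "p \<in> vanishing D" "q \<in> vanishing D"
    using p(2) q(2) M_1_right by (metis (mono_tags, lifting) mem_Collect_eq)+
  moreover have "zdeg p = zdeg q"
    using generator_min[OF p \<open>q \<in> _\<close>] generator_min[OF q \<open>p \<in> _\<close>] monic_nonzero[OF p(1)]
      monic_nonzero[OF q(1)] by (metis (mono_tags) linorder_neqE_nat mem_Collect_eq polys_below_def)
  moreover have "p - q \<in> vanishing D"
    using calculation by (simp add: vanishing_def E_diff)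
  ultimately show ?thesis
    using generator_min[OF p] monic_diff_polys_below[OF p(1) q(1)] by fastforce
qed

lemma minpolyI:
  assumes "monic p" "vanishing D = {M p g | g. True}"
  shows "minpoly D = p"
  unfolding minpoly_def
proof (rule the_equality)
  show "q = p" if "monic q \<and> vanishing D = {M q g | g. True}" for q
    using that by (intro generator_unique[OF _ _ assms]) simp_all
qed (use assms in simp)

lemma
  assumes "finite D"
  shows monic_minpoly: "monic (minpoly D)"
    and vanishing_eq: "vanishing D = {M (minpoly D) g | g. True}"
    and zdeg_minpoly_le: "zdeg (minpoly D) \<le> card D"
proof -
  obtain p where p: "monic p" "vanishing D = {M p g | g. True}" "zdeg p \<le> card D"
    using generator_exists[OF assms] by blast
  then have "minpoly D = p" by (intro minpolyI)
  with p show "monic (minpoly D)" "vanishing D = {M (minpoly D) g | g. True}"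
      "zdeg (minpoly D) \<le> card D"
    by simp_all
qed

lemma vanishing_zdeg_less:
  assumes "finite D" "f \<in> vanishing D" "f \<in> polys_below (zdeg (minpoly D))"
  shows "f = 0"
  by (rule generator_min[OF monic_minpoly[OF assms(1)] vanishing_eq[OF assms(1)] assms(2,3)])

lemma minpoly_vanishing:
  assumes "finite D"
  shows "minpoly D \<in> vanishing D"
  unfolding vanishing_eq[OF assms] using M_1_right[of "minpoly D", symmetric] by blast

text \<open>
  The bound on the degree leaves no room for a node that is already a root of the minimal
  polynomial of the others, so each node contributes exactly one linear factor.
\<close>

lemma
  assumes fin: "finite D" and indep: "zdeg (minpoly D) = card D" and x: "x \<in> D"
  defines "p \<equiv> minpoly (D - {x})"
  shows E_minpoly_delete: "E p x \<noteq> 0"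
    and minpoly_delete: "minpoly D = M p (linear_factor (conj (E p x) x))"
    and zdeg_minpoly_delete: "Suc (zdeg p) = card D"
proof -
  have D: "insert x (D - {x}) = D" and card: "Suc (card (D - {x})) = card D"
    using x card.remove[OF fin x] by auto
  have p: "monic p" "vanishing (D - {x}) = {M p g | g. True}" "zdeg p \<le> card (D - {x})"
    unfolding p_def using fin by (auto simp: monic_minpoly vanishing_eq zdeg_minpoly_le)
  show nz: "E p x \<noteq> 0"
  proof
    assume "E p x = 0"
    then have "minpoly D = p"
      using generator_insert(1)[OF p(1,2), of x] unfolding D by (intro minpolyI p(1))
    then show False using p(3) indep card by simp
  qed
  show eq: "minpoly D = M p (linear_factor (conj (E p x) x))"
    using generator_insert(2)[OF p(1,2) nz] unfolding D
    by (intro minpolyI M_monic p(1) monic_linear)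
  show "Suc (zdeg p) = card D"
    using eq indep zdeg_M[OF monic_nonzero[OF p(1)] linear_neq_0] by simp
qed

definition lagrange :: "'a set \<Rightarrow> ('a \<Rightarrow> 'a) \<Rightarrow> 'a zpoly" where
  "lagrange D w = (\<Sum>x\<in>D. M (minpoly (D - {x})) (cnst (quot (E (minpoly (D - {x})) x) (w x))))"

text \<open>
  A polynomial of degree below the number of nodes is determined by its values, since the
  difference of two candidates lies in an ideal generated by an element of
  degree \<open>card D\<close>.
\<close>

lemma
  assumes fin: "finite D" and indep: "zdeg (minpoly D) = card D"
  shows lagrange_polys_below: "lagrange D w \<in> polys_below (card D)"
    and E_lagrange: "x \<in> D \<Longrightarrow> E (lagrange D w) x = w x"
    and lagrange_E: "f \<in> polys_below (card D) \<Longrightarrow> lagrange D (E f) = f"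
proof -
  show below: "lagrange D w \<in> polys_below (card D)" for w
    unfolding lagrange_def
    using zdeg_minpoly_delete[OF fin indep]
    by (intro polys_below_sum M_cnst) (metis polys_below_self)
  show val: "E (lagrange D w) x = w x" if "x \<in> D" for w x
  proof -
    have "E (M (minpoly (D - {y})) (cnst c)) x = 0" if "y \<in> D - {x}" for y c
    proof (rule E_M_eq_0)
      show "E (minpoly (D - {y})) x = 0"
        using minpoly_vanishing[of "D - {y}"] that \<open>x \<in> D\<close> fin by (auto simp: vanishing_def)
    qed
    then show ?thesis
      unfolding lagrange_def E_sum
      using E_M_quot[OF E_minpoly_delete[OF fin indep that]]
      by (simp add: sum.remove[OF fin that])
  qed
  show "lagrange D (E f) = f" if "f \<in> polys_below (card D)"
  proof -
    have "lagrange D (E f) - f \<in> vanishing D"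
      by (simp add: vanishing_def E_diff val)
    moreover have "lagrange D (E f) - f \<in> polys_below (zdeg (minpoly D))"
      unfolding indep by (intro polys_below_diff below that)
    ultimately show ?thesis
      using vanishing_zdeg_less[OF fin] by fastforce
  qed
qed

end

interpretation left: evaluation "(*)" lval "\<lambda>v a. inverse v * a * v" "\<lambda>v c. inverse v * c"
proof
  fix f g :: "'a zpoly" and x :: 'a
  assume "lval f x \<noteq> 0"
  then show "lval (f * g) x = 0 \<longleftrightarrow> lval g (inverse (lval f x) * x * lval f x) = 0"
    using left_value_times[of f g x] lval_cnst_times[of "lval f x" g x] by simp
next
  fix f :: "'a zpoly" and x c :: 'a
  assume "lval f x \<noteq> 0"
  then show "lval (f * cnst (inverse (lval f x) * c)) x = c"
    by (simp flip: mult.assoc)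
qed (simp_all add: mult.assoc zdeg_times monic_times polys_below_iff lval_diff lval_add lval_eq_0_iff)

interpretation right: evaluation "\<lambda>f g. g * f" rval "\<lambda>v b. v * b * inverse v" "\<lambda>v c. c * inverse v"
proof
  fix f g :: "'a zpoly" and x :: 'a
  assume "rval f x \<noteq> 0"
  then show "rval (g * f) x = 0 \<longleftrightarrow> rval g (rval f x * x * inverse (rval f x)) = 0"
    using right_value_times[of g f x] rval_times_cnst[of "rval f x" g x] by simp
qed (simp_all add: mult.assoc zdeg_times monic_times polys_below_iff rval_diff rval_add rval_eq_0_iff)

lemma left_minpoly_eq: "left_minpoly D = left.minpoly D"
  by (simp add: left_minpoly_def left.minpoly_def left.vanishing_def)

lemma right_minpoly_eq: "right_minpoly D = right.minpoly D"
  by (simp add: right_minpoly_def right.minpoly_def right.vanishing_def)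

section \<open>Central polynomials\<close>

lemma center_comm: "z \<in> ring_center \<Longrightarrow> z * x = x * z"
  by (simp add: ring_center_def)

lemma center_mult: "y \<in> ring_center \<Longrightarrow> z \<in> ring_center \<Longrightarrow> y * z \<in> ring_center"
proof -
  assume y: "y \<in> ring_center" and z: "z \<in> ring_center"
  have "y * z * x = x * (y * z)" for x
  proof -
    have "y * z * x = y * x * z" by (simp only: mult.assoc center_comm[OF z, of x])
    also have "\<dots> = x * (y * z)" by (simp only: mult.assoc center_comm[OF y, of x])
    finally show ?thesis .
  qed
  then show ?thesis by (simp add: ring_center_def)
qed

lemma center_inverse:
  fixes z :: "'a::division_ring"
  assumes "z \<in> ring_center"
  shows "inverse z \<in> ring_center"
proof (cases "z = 0")
  case False
  have "inverse z * x = x * inverse z" for x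
  proof -
    have "inverse z * x = inverse z * (x * z) * inverse z"
      using False by (simp add: mult.assoc)
    also have "\<dots> = inverse z * (z * x) * inverse z"
      using center_comm[OF assms, of x] by simp
    also have "\<dots> = x * inverse z" using False by (simp flip: mult.assoc)
    finally show ?thesis .
  qed
  then show ?thesis by (simp add: ring_center_def)
qed (use assms in simp)

lemma central_poly_iff_commutes:
  fixes f :: "'a::ring_1 zpoly"
  shows "central_poly f \<longleftrightarrow> (\<forall>g. f * g = g * f)"
proof
  assume f: "central_poly f"
  show "\<forall>g. f * g = g * f"
  proof
    fix g
    show "f * g = g * f"
    proof (rule poly_mapping_eqI)
      fix m
      have "coef (f * g) m = (\<Sum>i\<le>m. coef g (m - i) * coef f i)"
        unfolding coef_times using f unfolding central_poly_def
        by (intro sum.cong refl center_comm) blast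
      also have "\<dots> = (\<Sum>i\<le>m. coef g i * coef f (m - i))"
        by (rule sum.reindex_bij_witness[where i = "\<lambda>i. m - i" and j = "\<lambda>i. m - i"]) auto
      finally show "coef (f * g) m = coef (g * f) m" by (simp add: coef_times)
    qed
  qed
next
  assume f: "\<forall>g. f * g = g * f"
  have "coef f m * c = c * coef f m" for m c
    using f[rule_format, of "cnst c"] by (metis coef_cnst_times coef_times_cnst)
  then show "central_poly f" by (simp add: central_poly_def ring_center_def)
qed

lemma central_commute: "central_poly f \<Longrightarrow> f * g = g * f" for f :: "'a::ring_1 zpoly"
  by (simp add: central_poly_iff_commutes)

lemma central_if_commutes_cnst:
  assumes "\<And>c. cnst c * f = f * cnst c"
  shows "central_poly f"
proof -
  have "coef f m * c = c * coef f m" for m c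
    using assms[of c] by (metis coef_cnst_times coef_times_cnst)
  then show ?thesis by (simp add: central_poly_def ring_center_def)
qed

lemma central_rval_eq_lval: "central_poly f \<Longrightarrow> rval f a = lval f a"
  unfolding rval_def lval_def central_poly_def by (intro sum.cong refl center_comm) blast

text \<open>
  \<open>k\<close> intertwines all powers of \<open>a\<close> and \<open>b\<close>, and it commutes with the coefficients.
\<close>

lemma central_intertwine:
  assumes "central_poly f" "a * k = k * b"
  shows "lval f a * k = k * lval f b"
proof -
  have pow: "a ^ m * k = k * b ^ m" for m
    by (induction m) (simp_all add: mult.assoc, metis assms(2) mult.assoc)
  have "coef f m * k = k * coef f m" for m
    using assms(1) center_comm unfolding central_poly_def by blast
  then have "a ^ m * coef f m * k = k * (b ^ m * coef f m)" for m
    by (metis pow mult.assoc)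
  then show ?thesis by (simp add: lval_def sum_distrib_left sum_distrib_right)
qed

lemma central_lval_times:
  assumes "central_poly f" "central_poly g"
  shows "lval (f * g) a = lval f a * lval g a"
proof -
  have "lval (f * g) a = lval (g * cnst (lval f a)) a"
    using left_value_times[of f g a] central_commute[OF assms(2)] by metis
  also have "\<dots> = lval g a * lval f a" by simp
  also have "\<dots> = lval f a * lval g a"
    using central_intertwine[OF assms(2), of a "lval f a" a] central_intertwine[OF assms(1), of a a a]
    by simp
  finally show ?thesis .
qed

lemma conjugate_iff: "conjugate a b \<longleftrightarrow> (\<exists>k. k \<noteq> 0 \<and> a * k = k * b)"
  for a b :: "'a::division_ring"
proof
  assume "conjugate a b"
  then obtain h where h: "h \<noteq> 0" "b = h * a * inverse h"
    by (auto simp: conjugate_def conj_class_def)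
  then have "a * inverse h = inverse h * b" by (simp flip: mult.assoc)
  then show "\<exists>k. k \<noteq> 0 \<and> a * k = k * b" using h(1) by (intro exI[of _ "inverse h"]) simp
next
  assume "\<exists>k. k \<noteq> 0 \<and> a * k = k * b"
  then obtain k where k: "k \<noteq> 0" "a * k = k * b" by blast
  then have "b = inverse k * a * inverse (inverse k)"
    by (simp add: mult.assoc) (simp flip: mult.assoc)
  then show "conjugate a b"
    using k(1) unfolding conjugate_def conj_class_def
    by (metis (mono_tags, lifting) mem_Collect_eq nonzero_imp_inverse_nonzero)
qed

lemma center_minpoly_exists:
  fixes a :: "'a::division_ring"
  assumes "algebraic_over_center a"
  shows "\<exists>!f. central_poly f \<and> monic f \<and> lval f a = 0 \<and>
     (\<forall>g. central_poly g \<and> g \<noteq> 0 \<and> lval g a = 0 \<longrightarrow> zdeg f \<le> zdeg g)"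
proof -
  let ?P = "\<lambda>f. central_poly f \<and> f \<noteq> 0 \<and> lval f a = 0"
  obtain f where f: "?P f" and min: "\<And>g. ?P g \<Longrightarrow> zdeg f \<le> zdeg g"
    using ex_has_least_nat[of ?P _ zdeg] assms unfolding algebraic_over_center_def by blast
  define h where "h = f * cnst (inverse (coef f (zdeg f)))"
  have lead: "coef f (zdeg f) \<noteq> 0" using f lead_coef_nonzero by blast
  have zdeg_h: "zdeg h = zdeg f"
    unfolding h_def using lead polys_below_self[of f]
    by (intro zdeg_eqI) (simp_all add: polys_below_iff)
  have h: "central_poly h" "monic h" "lval h a = 0" "\<And>g. ?P g \<Longrightarrow> zdeg h \<le> zdeg g"
  proof -
    show "central_poly h"
      using f by (simp add: h_def central_poly_def center_mult center_inverse)
    show "monic h" unfolding monic_def zdeg_h using lead by (simp add: h_def)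
    show "lval h a = 0" using f by (simp add: h_def)
  qed (use min zdeg_h in simp)
  have uniq: "h' = h" if h': "central_poly h'" "monic h'" "lval h' a = 0"
    "\<And>g. ?P g \<Longrightarrow> zdeg h' \<le> zdeg g" for h'
  proof (rule ccontr)
    assume "h' \<noteq> h"
    have "zdeg h' = zdeg h"
      by (rule antisym) (use h h' monic_nonzero in blast)+
    then have below: "h' - h \<in> polys_below (zdeg h)"
      using monic_diff_polys_below[OF h'(2) h(2)] by simp
    have "central_poly (h' - h)"
      using h(1) h'(1) by (simp add: central_poly_iff_commutes algebra_simps)
    then have "zdeg h \<le> zdeg (h' - h)"
      using h(3) h'(3) \<open>h' \<noteq> h\<close> by (intro h(4)) (simp add: lval_diff)
    then show False using below \<open>h' \<noteq> h\<close> by (simp add: polys_below_def)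
  qed
  show ?thesis
  proof (rule ex1I[of _ h])
    fix h' assume "central_poly h' \<and> monic h' \<and> lval h' a = 0 \<and>
      (\<forall>g. central_poly g \<and> g \<noteq> 0 \<and> lval g a = 0 \<longrightarrow> zdeg h' \<le> zdeg g)"
    then show "h' = h" by (intro uniq) auto
  qed (use h in simp)
qed

lemma
  fixes a :: "'a::division_ring"
  assumes "algebraic_over_center a"
  shows center_minpoly_central: "central_poly (center_minpoly a)"
    and center_minpoly_monic: "monic (center_minpoly a)"
    and lval_center_minpoly: "lval (center_minpoly a) a = 0"
    and zdeg_center_minpoly_le:
      "central_poly g \<Longrightarrow> g \<noteq> 0 \<Longrightarrow> lval g a = 0 \<Longrightarrow> zdeg (center_minpoly a) \<le> zdeg g"
proof -
  let ?X = "center_minpoly a"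
  have X: "central_poly ?X \<and> monic ?X \<and> lval ?X a = 0 \<and>
     (\<forall>g. central_poly g \<and> g \<noteq> 0 \<and> lval g a = 0 \<longrightarrow> zdeg ?X \<le> zdeg g)"
    unfolding center_minpoly_def by (rule theI'[OF center_minpoly_exists[OF assms]])
  show "central_poly ?X" using X by (elim conjE)
  show "monic ?X" using X by (elim conjE)
  show "lval ?X a = 0" using X by (elim conjE)
  show "zdeg ?X \<le> zdeg g" if "central_poly g" "g \<noteq> 0" "lval g a = 0"
    using X that by (elim conjE allE[of _ g] impE) simp_all
qed

section \<open>Intertwiners of conjugate elements\<close>

lemma Lquot_eqI:
  fixes a :: "'a::division_ring"
  assumes "f = cnst (lval f a) + linear_factor a * g"
  shows "Lquot a f = g"
proof -
  have uniq: "h = g" if "f = cnst (lval f a) + linear_factor a * h" for h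
  proof -
    from that[symmetric] assms
    have "cnst (lval f a) + linear_factor a * h = cnst (lval f a) + linear_factor a * g"
      by (rule trans)
    then have "linear_factor a * h = linear_factor a * g" by (simp only: add_left_cancel)
    then show "h = g" by (simp only: mult_left_cancel[OF linear_neq_0])
  qed
  show ?thesis
    unfolding Lquot_def by (rule the_equality; fold linear_factor_def) (rule assms, erule uniq)
qed

lemma linear_factor_times_Lquot:
  fixes a :: "'a::division_ring"
  shows "f = cnst (lval f a) + linear_factor a * Lquot a f"
proof -
  obtain g where g: "f = cnst (lval f a) + linear_factor a * g"
    using left_remainder by blast
  show ?thesis unfolding Lquot_eqI[OF g] by (rule g)
qed

text \<open>
  Division with remainder with the divisor on the left: subtracting \<open>h\<close> times a monomial cancels
  the top coefficient of \<open>f\<close>.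
\<close>

lemma monic_division:
  fixes f h :: "'a::division_ring zpoly"
  assumes "monic h"
  shows "\<exists>s r. f = h * s + r \<and> r \<in> polys_below (zdeg h)"
proof -
  have "\<exists>s r. f = h * s + r \<and> r \<in> polys_below (zdeg h)" if "f \<in> polys_below N" for N f
    using that
  proof (induction N arbitrary: f)
    case 0
    then have "f = 0" by (simp add: polys_below_def)
    then show ?case by (intro exI[of _ 0]) (simp add: polys_below_def)
  next
    case (Suc N)
    show ?case
    proof (cases "N < zdeg h")
      case True
      then have "f \<in> polys_below (zdeg h)" using Suc.prems polys_below_mono by fastforce
      then show ?thesis by (intro exI[of _ 0] exI[of _ f]) simp
    next
      case False
      define t where "t = Poly_Mapping.single (N - zdeg h) (coef f N)"
      have t: "t \<in> polys_below (Suc (N - zdeg h))"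
        by (simp add: t_def polys_below_iff lookup_single)
      have "h * t \<in> polys_below (Suc N)"
        using polys_below_times[OF polys_below_self t, of h] False by simp
      moreover have "coef (h * t) N = coef f N"
        using lead_coef_times[OF polys_below_self t, of h] False assms
        by (simp add: t_def monic_def)
      ultimately have "f - h * t \<in> polys_below N"
        using Suc.prems unfolding polys_below_iff lookup_minus
        by (metis cancel_comm_monoid_add_class.diff_cancel le_antisym not_less_eq_eq)
      then obtain s r where "f - h * t = h * s + r" "r \<in> polys_below (zdeg h)"
        using Suc.IH by blast
      then have "f = h * (t + s) + r" by (simp add: distrib_left algebra_simps)
      then show ?thesis using \<open>r \<in> _\<close> by blast
    qed
  qed
  then show ?thesis using polys_below_self by blast
qed

text \<open>
  The polynomials that annihilate the module of right values at \<open>b\<close> form a two-sided ideal.  Its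
  monic element \<open>h\<close> of least degree is central, because \<open>c h - h c\<close> lies in the ideal and has
  smaller degree.  This is the independence argument of Dedekind and Artin for the powers of right
  multiplication by \<open>b\<close>.
\<close>

lemma right_annihilator_central:
  fixes f :: "'a::division_ring zpoly"
  assumes f: "f \<noteq> 0" "\<And>w. rval (f * cnst w) b = 0"
  obtains h where "central_poly h" "monic h" "zdeg h \<le> zdeg f"
    "\<And>w. rval (h * cnst w) b = 0"
    "\<And>g. (\<And>w. rval (g * cnst w) b = 0) \<Longrightarrow> \<exists>s. g = h * s"
proof -
  let ?I = "\<lambda>g. \<forall>w. rval (g * cnst w) b = 0"
  have I_left: "?I (g * g')" if "?I g'" for g g'
    using that right_value_times[of g "g' * cnst w" b for w] by (simp add: mult.assoc)
  have I_right: "?I (g * g')" if "?I g" for g g'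
    using that right_value_times[of g "g' * cnst w" b for w] by (simp add: mult.assoc)
  have I_diff: "?I (g - g')" if "?I g" "?I g'" for g g'
    using that by (simp add: left_diff_distrib rval_diff)
  obtain h0 where h0: "h0 \<noteq> 0" "?I h0" and min: "\<And>g. g \<noteq> 0 \<and> ?I g \<Longrightarrow> zdeg h0 \<le> zdeg g"
    using ex_has_least_nat[of "\<lambda>g. g \<noteq> 0 \<and> ?I g" f zdeg] f by blast
  define h where "h = cnst (inverse (coef h0 (zdeg h0))) * h0"
  have lead: "coef h0 (zdeg h0) \<noteq> 0" using h0 lead_coef_nonzero by blast
  have zdeg_h: "zdeg h = zdeg h0"
    unfolding h_def using lead polys_below_self[of h0]
    by (intro zdeg_eqI) (simp_all add: polys_below_iff)
  have monic: "monic h"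
    unfolding monic_def zdeg_h using lead by (simp add: h_def)
  have I_h: "?I h" unfolding h_def by (rule I_left[OF h0(2)])
  have zero: "g = 0" if "?I g" "g \<in> polys_below (zdeg h)" for g
    using min[of g] that zdeg_h by (force simp: polys_below_def)
  have "central_poly h"
  proof (rule central_if_commutes_cnst)
    fix c
    have "cnst c * h - h * cnst c \<in> polys_below (zdeg h)"
      unfolding polys_below_iff lookup_minus coef_cnst_times coef_times_cnst
    proof (intro allI impI)
      fix m assume "zdeg h \<le> m"
      then consider "m = zdeg h" | "coef h m = 0"
        using polys_below_self[of h] by (metis Suc_leI le_neq_implies_less polys_below_iff)
      then show "c * coef h m - coef h m * c = 0"
        by cases (use monic in \<open>simp_all add: monic_def\<close>)
    qed
    then show "cnst c * h = h * cnst c"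
      using zero[OF I_diff[OF I_left[OF I_h] I_right[OF I_h]]] by simp
  qed
  moreover have "zdeg h \<le> zdeg f" using min f zdeg_h by simp
  moreover have "\<exists>s. g = h * s" if "?I g" for g
  proof -
    obtain s r where sr: "g = h * s + r" "r \<in> polys_below (zdeg h)"
      using monic_division[OF monic] by blast
    then have "r = g - h * s" by simp
    then have "r = 0" using zero I_diff[OF that I_right[OF I_h]] sr(2) by blast
    then show ?thesis using sr(1) by auto
  qed
  ultimately show thesis using that[of h] monic I_h by blast
qed

lemma central_rval_times_cnst:
  assumes "central_poly X"
  shows "rval (X * cnst w) b = w * lval X b"
  unfolding central_commute[OF assms, of "cnst w"] rval_cnst_times
    central_rval_eq_lval[OF assms] ..

text \<open>
  The factor \<open>z - a\<close> can be cancelled from \<open>(z - a) L (z - a) = X (z - a) = (z - a) X\<close>, so it may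
  be split off from the central polynomial \<open>X\<close> on either side.
\<close>

lemma Lquot_center_minpoly:
  fixes a :: "'a::division_ring"
  assumes alg: "algebraic_over_center a"
  defines "X \<equiv> center_minpoly a" and "L \<equiv> Lquot a (center_minpoly a)"
  shows "linear_factor a * L = X" "L * linear_factor a = X" "L \<noteq> 0" "Suc (zdeg L) = zdeg X"
proof -
  show 1: "linear_factor a * L = X"
    using linear_factor_times_Lquot[of X a] lval_center_minpoly[OF alg] by (simp add: X_def L_def)
  have X: "X \<noteq> 0" unfolding X_def using center_minpoly_monic[OF alg] monic_nonzero by blast
  have "linear_factor a * (L * linear_factor a) = X * linear_factor a"
    using 1 by (simp flip: mult.assoc)
  also have "\<dots> = linear_factor a * X"
    unfolding X_def using center_minpoly_central[OF alg] central_commute by blast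
  finally show "L * linear_factor a = X" by simp
  show "L \<noteq> 0" using 1 X by auto
  then show "Suc (zdeg L) = zdeg X"
    unfolding 1[symmetric] using zdeg_times[of "linear_factor a" L] by simp
qed

text \<open>
  If \<open>L\<close> annihilated everything, the generator \<open>h\<close> of the annihilator would be a central divisor
  of \<open>X\<close> of degree less than \<open>deg X\<close>.  Then \<open>X = h s\<close> with \<open>s\<close> central, and minimality of \<open>X\<close>
  forces \<open>h(a) \<noteq> 0\<close>, hence \<open>s(a) = 0\<close>, hence \<open>deg s = deg X\<close> and \<open>h = 1\<close>, which annihilates
  nothing.  The values obtained are nonzero intertwiners of \<open>a\<close> and \<open>b\<close>, since
  \<open>(z - a) L = X\<close> acts as multiplication by \<open>X(b) = 0\<close>.
\<close>

lemma intertwiner_nonzero_exists: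
  fixes a b :: "'a::division_ring"
  assumes alg: "algebraic_over_center a" and b: "lval (center_minpoly a) b = 0"
  shows "\<exists>w. rval (Lquot a (center_minpoly a) * cnst w) b \<noteq> 0"
proof (rule ccontr)
  let ?X = "center_minpoly a" and ?L = "Lquot a (center_minpoly a)"
  note X = center_minpoly_central[OF alg]
  assume "\<nexists>w. rval (?L * cnst w) b \<noteq> 0"
  then have "\<And>w. rval (?L * cnst w) b = 0" by blast
  then obtain h where h: "central_poly h" "monic h" "zdeg h \<le> zdeg ?L"
    and h0: "\<And>w. rval (h * cnst w) b = 0"
    and hdvd: "\<And>g. (\<And>w. rval (g * cnst w) b = 0) \<Longrightarrow> \<exists>s. g = h * s"
    using right_annihilator_central[OF Lquot_center_minpoly(3)[OF alg]] by metis
  have h_less: "zdeg h < zdeg ?X" using h(3) Lquot_center_minpoly(4)[OF alg] by simp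
  obtain s where s: "?X = h * s"
    using hdvd[of ?X] central_rval_times_cnst[OF X] b by auto
  have nz: "h \<noteq> 0" "s \<noteq> 0"
    using s monic_nonzero[OF center_minpoly_monic[OF alg]] by auto
  \<comment> \<open>Cancel \<open>h\<close> in \<open>h (s g) = X g = g X = h (g s)\<close>.\<close>
  have "central_poly s"
  proof -
    have "s * g = g * s" for g
    proof -
      have "h * (s * g) = (h * g) * s"
        using central_commute[OF X, of g] central_commute[OF h(1), of g] s by (metis mult.assoc)
      then show ?thesis using nz(1) by (simp add: mult.assoc)
    qed
    then show ?thesis by (simp add: central_poly_iff_commutes)
  qed
  have "lval h a \<noteq> 0"
    using zdeg_center_minpoly_le[OF alg h(1) nz(1)] h_less by auto
  moreover have "lval h a * lval s a = 0"
    using central_lval_times[OF h(1) \<open>central_poly s\<close>, of a] lval_center_minpoly[OF alg] s by simp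
  ultimately have "lval s a = 0" by simp
  then have "zdeg ?X \<le> zdeg s"
    using zdeg_center_minpoly_le[OF alg \<open>central_poly s\<close> nz(2)] by simp
  then have "zdeg h = 0" using s zdeg_times[OF nz] by simp
  then have "h = 1"
    using h(2) polys_below_self[of h]
    by (intro poly_mapping_eqI) (auto simp: monic_def polys_below_iff lookup_one when_def)
  then show False using h0[of 1] by simp
qed

lemma rval_linear_times: "rval (linear_factor a * g) b = rval g b * b - a * rval g b"
  using right_value_times[of "linear_factor a" g b]
  by (simp add: linear_factor_def left_diff_distrib mult_single rval_diff)

lemma center_minpoly_root_iff_conjugate:
  fixes a b :: "'a::division_ring"
  assumes alg: "algebraic_over_center a"
  shows "lval (center_minpoly a) b = 0 \<longleftrightarrow> conjugate a b"
proof
  assume "conjugate a b"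
  then obtain k where k: "k \<noteq> 0" "a * k = k * b" by (auto simp: conjugate_iff)
  then show "lval (center_minpoly a) b = 0"
    using central_intertwine[OF center_minpoly_central[OF alg] k(2)] lval_center_minpoly[OF alg]
    by simp
next
  let ?X = "center_minpoly a" and ?L = "Lquot a (center_minpoly a)"
  assume b: "lval (center_minpoly a) b = 0"
  obtain w where w: "rval (?L * cnst w) b \<noteq> 0"
    using intertwiner_nonzero_exists[OF alg b] by blast
  let ?k = "rval (?L * cnst w) b"
  have "?k * b - a * ?k = rval (?X * cnst w) b"
    using rval_linear_times[of a "?L * cnst w" b] Lquot_center_minpoly(1)[OF alg]
    by (simp flip: mult.assoc)
  also have "\<dots> = 0" using central_rval_times_cnst[OF center_minpoly_central[OF alg]] b by simp
  finally show "conjugate a b" using w by (auto simp: conjugate_iff)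
qed

text \<open>
  Modulo \<open>X\<close> this makes \<open>z - a\<close> a von Neumann regular element: \<open>-G\<close> is a quasi-inverse
  of it, and \<open>cnst w * L\<close> is the complementary idempotent.  The element \<open>w\<close> is chosen so that
  \<open>L * cnst w\<close> has the right value \<open>1\<close> at \<open>a\<close>, which gives the mirrored identity
  \<open>L * cnst w = 1 + G * (z - a)\<close>; centrality of \<open>X\<close> moves the factor \<open>z - a\<close> to the other side.
\<close>

lemma Lquot_times_cnst_left_inverse:
  fixes a :: "'a::division_ring"
  assumes alg: "algebraic_over_center a"
  shows "\<exists>w G. cnst w * Lquot a (center_minpoly a) = 1 + linear_factor a * G"
proof -
  let ?X = "center_minpoly a" and ?L = "Lquot a (center_minpoly a)"
  note X = center_minpoly_central[OF alg]
  obtain w0 where w0: "rval (?L * cnst w0) a \<noteq> 0"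
    using intertwiner_nonzero_exists[OF alg lval_center_minpoly[OF alg]] by blast
  define k where "k = rval (?L * cnst w0) a"
  \<comment> \<open>Scaling on the right by an element commuting with \<open>a\<close> scales the value; this makes it \<open>1\<close>.\<close>
  define w where "w = w0 * inverse k"
  have "k * a - a * k = 0"
    using rval_linear_times[of a "?L * cnst w0" a] Lquot_center_minpoly(1)[OF alg]
      central_rval_times_cnst[OF X] lval_center_minpoly[OF alg]
    by (simp add: k_def flip: mult.assoc)
  then have "inverse k * a * inverse (inverse k) = a"
    using w0 by (simp add: k_def mult.assoc) (metis mult.assoc left_inverse mult_1)
  then have "rval (?L * cnst w) a = k * inverse k"
    using rval_times_cnst[of "inverse k" "?L * cnst w0" a] w0
    by (simp add: k_def w_def mult_single mult.assoc)
  then have "rval (?L * cnst w) a = 1" using w0 by (simp add: k_def)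
  then obtain G where G: "?L * cnst w = 1 + G * linear_factor a"
    using right_remainder[of "?L * cnst w" a] by auto
  have "(cnst w * ?L) * linear_factor a = cnst w * ?X"
    by (simp add: mult.assoc Lquot_center_minpoly(2)[OF alg])
  also have "\<dots> = linear_factor a * (?L * cnst w)"
    using central_commute[OF X] Lquot_center_minpoly(1)[OF alg] by (metis mult.assoc)
  also have "\<dots> = (1 + linear_factor a * G) * linear_factor a"
    unfolding G by (simp add: distrib_left distrib_right mult.assoc)
  finally have "cnst w * ?L = 1 + linear_factor a * G" by simp
  then show ?thesis by blast
qed

section \<open>The equation a x - x b = c\<close>

text \<open>
  Let both sides of \<open>cnst w * L = 1 + (z - a) * G\<close> act on \<open>c\<close>: the left side gives \<open>0\<close>, the right
  side \<open>c + (x b - a x)\<close> with \<open>x\<close> the value of \<open>G * cnst c\<close>.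
\<close>

lemma sylvester_conjugate:
  fixes a b :: "'a::division_ring"
  assumes alg: "algebraic_over_center a"
    and c: "rval (Lquot a (center_minpoly a) * cnst c) b = 0"
  shows "\<exists>x. a * x - x * b = c"
proof -
  let ?L = "Lquot a (center_minpoly a)"
  obtain w G where G: "cnst w * ?L = 1 + linear_factor a * G"
    using Lquot_times_cnst_left_inverse[OF alg] by blast
  define x where "x = rval (G * cnst c) b"
  have "0 = rval ((cnst w * ?L) * cnst c) b"
    using c by (simp add: mult.assoc)
  also have "\<dots> = c + (x * b - a * x)"
    unfolding G by (simp add: distrib_right rval_add mult.assoc rval_linear_times x_def)
  finally have "a * x - x * b = c" by (simp add: algebra_simps)
  then show ?thesis by blast
qed

text \<open>
  Evaluate \<open>(z - a) * L * cnst c = X * cnst c\<close> at \<open>b\<close> and divide by \<open>X(b)\<close>, which commutes with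
  \<open>b\<close> and is nonzero because the roots of \<open>X\<close> are the conjugates of \<open>a\<close>.
\<close>

lemma sylvester_not_conjugate:
  fixes a b :: "'a::division_ring"
  assumes alg: "algebraic_over_center a" and nc: "\<not> conjugate a b"
  shows "a * Psi a b c - Psi a b c * b = c"
proof -
  let ?X = "center_minpoly a" and ?L = "Lquot a (center_minpoly a)"
  note X = center_minpoly_central[OF alg]
  define y where "y = rval (?L * cnst c) b"
  define v where "v = lval ?X b"
  have v: "v \<noteq> 0" unfolding v_def using center_minpoly_root_iff_conjugate[OF alg] nc by blast
  have Psi: "Psi a b c = - y * inverse v"
    using nc by (simp add: Psi_def Let_def y_def v_def)
  have "v * b = b * v"
    unfolding v_def using central_intertwine[OF X, of b b b] by simp
  then have bv: "inverse v * b = b * inverse v"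
    using v by (metis (no_types, lifting) mult.assoc left_inverse right_inverse mult_1 mult.right_neutral)
  have "y * b - a * y = c * v"
    using rval_linear_times[of a "?L * cnst c" b] Lquot_center_minpoly(1)[OF alg]
      central_rval_times_cnst[OF X, of c b]
    by (simp add: y_def v_def flip: mult.assoc)
  moreover have "a * Psi a b c - Psi a b c * b = (y * b - a * y) * inverse v"
    unfolding Psi by (simp add: mult.assoc bv left_diff_distrib)
  ultimately have "a * Psi a b c - Psi a b c * b = (c * v) * inverse v" by simp
  then show ?thesis using v by (simp add: mult.assoc)
qed

section \<open>Taylor expansion of central polynomials\<close>

text \<open>
  The kernel of this map consists of the intertwiners of \<open>a\<close> and \<open>b\<close>; for \<open>a = b\<close> it is the usual
  inner derivation.
\<close>

definition inner_deriv :: "'a::ring_1 \<Rightarrow> 'a \<Rightarrow> 'a \<Rightarrow> 'a" where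
  "inner_deriv a b x = a * x - x * b"

lemma inner_deriv_sum: "inner_deriv a b (\<Sum>i\<in>I. f i) = (\<Sum>i\<in>I. inner_deriv a b (f i))"
  by (simp add: inner_deriv_def sum_distrib_left sum_distrib_right sum_subtractf)

lemma inner_deriv_mult_right:
  assumes "b * t = t * b"
  shows "inner_deriv a b (x * t) = inner_deriv a b x * t"
  using assms by (simp add: inner_deriv_def left_diff_distrib mult.assoc)

lemma inner_deriv_of_nat_mult: "inner_deriv a b (of_nat r * x) = of_nat r * inner_deriv a b x"
proof -
  have "a * (of_nat r * x) = of_nat r * (a * x)"
    by (metis mult.assoc mult_of_nat_commute)
  then show ?thesis
    by (simp add: inner_deriv_def right_diff_distrib mult.assoc)
qed

text \<open>
  The binomial theorem for the difference of the commuting maps \<open>x \<mapsto> a x\<close> and \<open>x \<mapsto> x b\<close>.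
\<close>

lemma funpow_inner_deriv:
  "(inner_deriv a b ^^ j) x =
    (\<Sum>i\<le>j. (- 1) ^ (i + j) * of_nat (j choose i) * (a ^ i * x * b ^ (j - i)))"
  for a :: "'a::ring_1"
proof (induction j)
  case 0
  show ?case by simp
next
  case (Suc j)
  define T where "T i m = a ^ i * x * b ^ m" for i m
  have aT: "a * T i m = T (Suc i) m" for i m
    by (simp add: T_def mult.assoc)
  have Tb: "T i m * b = T i (Suc m)" for i m
    by (simp add: T_def mult.assoc power_Suc2 del: power_Suc)
  have comm: "y * ((- 1) ^ i * of_nat r * z) = (- 1) ^ i * of_nat r * (y * z)" for i r and y z :: 'a
  proof -
    have "(-1) ^ i * of_nat r = (of_int ((-1) ^ i * int r) :: 'a)" by simp
    then show ?thesis by (metis mult.assoc mult_of_int_commute)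
  qed
  let ?S = "\<Sum>i\<le>j. (- 1) ^ (i + j) * of_nat (j choose i) * T i (j - i)"
  have "(inner_deriv a b ^^ Suc j) x = inner_deriv a b ?S"
    by (simp only: funpow.simps o_apply Suc.IH T_def)
  also have "\<dots> = a * ?S - ?S * b"
    by (simp only: inner_deriv_def)
  also have "a * ?S = (\<Sum>i\<le>j. (- 1) ^ (i + j) * of_nat (j choose i) * T (Suc i) (j - i))"
    by (simp only: sum_distrib_left comm aT)
  also have "?S * b = (\<Sum>i\<le>j. (- 1) ^ (i + j) * of_nat (j choose i) * T i (Suc j - i))"
    unfolding sum_distrib_right by (rule sum.cong) (simp_all add: mult.assoc Tb Suc_diff_le)
  also have "(\<Sum>i\<le>j. (- 1) ^ (i + j) * of_nat (j choose i) * T (Suc i) (j - i))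
      = (\<Sum>i\<le>Suc j. (- 1) ^ (i + Suc j) * of_nat (if i = 0 then 0 else j choose (i - 1)) * T i (Suc j - i))"
    by (subst sum.atMost_Suc_shift) simp
  also have "(\<Sum>i\<le>j. (- 1) ^ (i + j) * of_nat (j choose i) * T i (Suc j - i))
      = (\<Sum>i\<le>Suc j. (- 1) ^ (i + j) * of_nat (j choose i) * T i (Suc j - i))"
    by (simp add: binomial_eq_0)
  also have "(\<Sum>i\<le>Suc j. (- 1) ^ (i + Suc j) * of_nat (if i = 0 then 0 else j choose (i - 1)) * T i (Suc j - i))
     - \<dots> = (\<Sum>i\<le>Suc j. (- 1) ^ (i + Suc j) * of_nat (Suc j choose i) * T i (Suc j - i))"
    unfolding sum_subtractf[symmetric]
  proof (rule sum.cong)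
    fix i assume "i \<in> {..Suc j}"
    show "(- 1) ^ (i + Suc j) * of_nat (if i = 0 then 0 else j choose (i - 1)) * T i (Suc j - i)
        - (- 1) ^ (i + j) * of_nat (j choose i) * T i (Suc j - i)
        = (- 1) ^ (i + Suc j) * of_nat (Suc j choose i) * T i (Suc j - i)"
      by (cases i) (simp_all add: algebra_simps)
  qed simp
  finally show ?case by (simp add: T_def)
qed

lemma coef_formal_deriv: "coef (formal_deriv f) m = of_nat (Suc m) * coef f (Suc m)"
proof -
  have "coef (formal_deriv f) m
      = (\<Sum>l\<in>Poly_Mapping.keys f. if l = Suc m then of_nat (Suc m) * coef f (Suc m) else 0)"
    unfolding formal_deriv_def lookup_sum
  proof (rule sum.cong)
    fix l assume "l \<in> Poly_Mapping.keys f"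
    show "coef (Poly_Mapping.single (l - 1) (of_nat l * coef f l)) m
        = (if l = Suc m then of_nat (Suc m) * coef f (Suc m) else 0)"
      by (cases l) (auto simp: lookup_single when_def)
  qed simp
  also have "\<dots> = of_nat (Suc m) * coef f (Suc m)"
    by (auto simp: in_keys_iff)
  finally show ?thesis .
qed

lemma coef_formal_deriv_funpow:
  "coef ((formal_deriv ^^ j) f) m = of_nat (fact j * ((m + j) choose j)) * coef f (m + j)"
  for f :: "'a::ring_1 zpoly"
proof (induction j arbitrary: m)
  case (Suc j)
  have "Suc m * ((Suc m + j) choose j) = Suc j * ((m + Suc j) choose Suc j)"
    using Suc_times_binomial_add[of j m] by (simp only: add_Suc add_Suc_right add.commute[of j m])
  then have *: "Suc m * (fact j * ((Suc m + j) choose j)) = fact (Suc j) * ((m + Suc j) choose Suc j)"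
    by (simp add: algebra_simps)
  have "coef ((formal_deriv ^^ Suc j) f) m
      = of_nat (Suc m * (fact j * ((Suc m + j) choose j))) * coef f (Suc m + j)"
    by (simp only: funpow.simps o_apply coef_formal_deriv Suc of_nat_mult mult.assoc)
  also have "\<dots> = of_nat (fact (Suc j) * ((m + Suc j) choose Suc j)) * coef f (m + Suc j)"
    unfolding * by simp
  finally show ?case .
qed simp

text \<open>
  The value at \<open>b\<close> of the \<open>j\<close>-th Hasse derivative, that is of \<open>f\<^sup>(\<^sup>j\<^sup>) / j!\<close> without the division.
\<close>

definition hasse_value :: "nat \<Rightarrow> 'a::ring_1 zpoly \<Rightarrow> 'a \<Rightarrow> 'a" where
  "hasse_value j f b = (\<Sum>m\<in>Poly_Mapping.keys f. of_nat (m choose j) * (b ^ (m - j) * coef f m))"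

lemma lval_polys_below:
  "f \<in> polys_below N \<Longrightarrow> lval f a = (\<Sum>m<N. a ^ m * coef f m)"
  by (rule lval_supset) (auto simp: polys_below_iff in_keys_iff linorder_not_less[symmetric])

lemma lval_formal_deriv_funpow:
  "lval ((formal_deriv ^^ j) f) b = of_nat (fact j) * hasse_value j f b"
  for f :: "'a::ring_1 zpoly"
proof -
  let ?N = "Suc (zdeg f)"
  have f: "f \<in> polys_below ?N" by (rule polys_below_self)
  have "lval ((formal_deriv ^^ j) f) b = (\<Sum>m<?N. b ^ m * coef ((formal_deriv ^^ j) f) m)"
    using f by (intro lval_polys_below) (simp add: polys_below_iff coef_formal_deriv_funpow)
  also have "\<dots> = (\<Sum>m<?N. of_nat (fact j) * (of_nat ((m + j) choose j) * (b ^ m * coef f (m + j))))"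
  proof (rule sum.cong)
    fix m
    show "b ^ m * coef ((formal_deriv ^^ j) f) m
        = of_nat (fact j) * (of_nat ((m + j) choose j) * (b ^ m * coef f (m + j)))"
      unfolding coef_formal_deriv_funpow
      by (metis mult.assoc mult_of_nat_commute of_nat_mult)
  qed simp
  also have "\<dots> = (\<Sum>m\<in>{j..<?N + j}. of_nat (fact j) * (of_nat (m choose j) * (b ^ (m - j) * coef f m)))"
    by (rule sum.reindex_bij_witness[where i = "\<lambda>m. m - j" and j = "\<lambda>m. m + j"]) auto
  also have "\<dots> = (\<Sum>m\<in>Poly_Mapping.keys f. of_nat (fact j) * (of_nat (m choose j) * (b ^ (m - j) * coef f m)))"
  proof (rule sum.mono_neutral_cong)
    fix m assume "m \<in> {j..<?N + j} - Poly_Mapping.keys f"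
    then show "of_nat (fact j) * (of_nat (m choose j) * (b ^ (m - j) * coef f m)) = 0"
      by (simp add: in_keys_iff)
  next
    fix m assume "m \<in> Poly_Mapping.keys f - {j..<?N + j}"
    then show "of_nat (fact j) * (of_nat (m choose j) * (b ^ (m - j) * coef f m)) = 0"
      using f by (cases "m < j") (auto simp: polys_below_iff binomial_eq_0)
  qed auto
  finally show ?thesis by (simp add: hasse_value_def sum_distrib_left)
qed

text \<open>
  With \<open>A\<close> the left multiplication by \<open>a\<close> and \<open>B\<close> the right multiplication by \<open>b\<close>, this is the
  expansion of \<open>(A\<^sup>m - B\<^sup>m) / (A - B)\<close> in powers of \<open>A - B\<close>.  It goes by induction, since
  \<open>A - B\<close> need not be injective and cannot be cancelled.
\<close>

lemma geometric_sum_inner_deriv: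
  "(\<Sum>i<m. a ^ (m - Suc i) * x * b ^ i)
    = (\<Sum>j<m. of_nat (m choose Suc j) * ((inner_deriv a b ^^ j) x * b ^ (m - Suc j)))"
  for a :: "'a::ring_1"
proof (induction m)
  case (Suc m)
  define D where "D j = (inner_deriv a b ^^ j) x" for j
  let ?S = "\<lambda>m. \<Sum>i<m. a ^ (m - Suc i) * x * b ^ i"
  let ?R = "\<lambda>m. \<Sum>j<m. of_nat (m choose Suc j) * (D j * b ^ (m - Suc j))"
  have D_Suc: "inner_deriv a b (of_nat r * (D j * b ^ l)) = of_nat r * (D (Suc j) * b ^ l)" for r j l
    by (simp add: inner_deriv_of_nat_mult inner_deriv_mult_right power_commutes D_def)
  have pow: "a ^ (m - i) = a * a ^ (m - Suc i)" if "i < m" for i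
    using that by (simp add: Suc_diff_Suc flip: power_Suc)
  have powb: "b ^ (m - i) = b ^ (m - Suc i) * b" if "i < m" for i
    using that by (simp add: Suc_diff_Suc flip: power_Suc2)
  have "?S (Suc m) = a * ?S m + x * b ^ m"
    by (simp add: sum_distrib_left) (rule sum.cong, simp_all add: pow mult.assoc)
  also have "\<dots> = inner_deriv a b (?S m) + ?S m * b + x * b ^ m"
    by (simp add: inner_deriv_def)
  also have "?S m = ?R m"
    using Suc by (simp add: D_def)
  also have "inner_deriv a b (?R m) + ?R m * b + x * b ^ m = ?R (Suc m)"
  proof -
    have "?R (Suc m) = (\<Sum>j<Suc m. of_nat (m choose j) * (D j * b ^ (m - j)))
        + (\<Sum>j<Suc m. of_nat (m choose Suc j) * (D j * b ^ (m - j)))"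
      by (simp add: distrib_right sum.distrib)
    \<comment> \<open>Pascal's rule has split the sum; its two parts account for \<open>A - B\<close> and for \<open>B\<close>.\<close>
    also have "(\<Sum>j<Suc m. of_nat (m choose j) * (D j * b ^ (m - j))) = x * b ^ m + inner_deriv a b (?R m)"
      unfolding sum.lessThan_Suc_shift inner_deriv_sum D_Suc by (simp add: D_def)
    also have "(\<Sum>j<Suc m. of_nat (m choose Suc j) * (D j * b ^ (m - j))) = ?R m * b"
      by (simp add: sum_distrib_right binomial_eq_0) (rule sum.cong, simp_all add: powb mult.assoc)
    finally show ?thesis by (simp add: algebra_simps)
  qed
  finally show ?case by (simp add: D_def)
qed simp

lemma single_eq_linear_factor:
  "Poly_Mapping.single m c = cnst (a ^ m * c)
     + linear_factor a * (\<Sum>i<m. Poly_Mapping.single i (a ^ (m - Suc i) * c))"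
  for a :: "'a::ring_1"
proof (induction m)
  case (Suc m)
  have "Poly_Mapping.single (Suc m) c = cnst a * Poly_Mapping.single m c
      + linear_factor a * Poly_Mapping.single m c"
    by (simp add: linear_factor_def left_diff_distrib mult_single)
  also have "cnst a * Poly_Mapping.single m c
      = cnst (a ^ Suc m * c) + cnst a * (linear_factor a * (\<Sum>i<m. Poly_Mapping.single i (a ^ (m - Suc i) * c)))"
    by (subst Suc) (simp add: distrib_left mult_single mult.assoc)
  also have "cnst a * (linear_factor a * (\<Sum>i<m. Poly_Mapping.single i (a ^ (m - Suc i) * c)))
      = linear_factor a * (cnst a * (\<Sum>i<m. Poly_Mapping.single i (a ^ (m - Suc i) * c)))"
    by (simp add: linear_factor_def left_diff_distrib right_diff_distrib mult_single flip: mult.assoc)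
  also have "cnst a * (\<Sum>i<m. Poly_Mapping.single i (a ^ (m - Suc i) * c))
      = (\<Sum>i<m. Poly_Mapping.single i (a ^ (Suc m - Suc i) * c))"
    unfolding sum_distrib_left
  proof (rule sum.cong)
    fix i assume "i \<in> {..<m}"
    then have "a ^ (Suc m - Suc i) = a * a ^ (m - Suc i)"
      by (simp add: Suc_diff_Suc flip: power_Suc)
    then show "cnst a * Poly_Mapping.single i (a ^ (m - Suc i) * c)
        = Poly_Mapping.single i (a ^ (Suc m - Suc i) * c)"
      by (simp add: mult_single mult.assoc)
  qed simp
  finally show ?case by (simp add: distrib_left)
qed simp

lemma Lquot_eq:
  "Lquot a f = (\<Sum>m\<in>Poly_Mapping.keys f. \<Sum>i<m. Poly_Mapping.single i (a ^ (m - Suc i) * coef f m))"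
  for a :: "'a::division_ring"
proof (rule Lquot_eqI)
  have "f = (\<Sum>m\<in>Poly_Mapping.keys f. Poly_Mapping.single m (coef f m))"
    by (rule poly_mapping_eqI) (simp add: lookup_sum lookup_single when_def in_keys_iff)
  also have "\<dots> = cnst (lval f a) + linear_factor a *
    (\<Sum>m\<in>Poly_Mapping.keys f. \<Sum>i<m. Poly_Mapping.single i (a ^ (m - Suc i) * coef f m))"
  proof -
    show ?thesis
      unfolding lval_def cnst_sum sum_distrib_left[of "linear_factor a" _ "Poly_Mapping.keys f"] sum.distrib[symmetric]
      by (intro sum.cong refl single_eq_linear_factor)
  qed
  finally show "f = cnst (lval f a) + linear_factor a *
    (\<Sum>m\<in>Poly_Mapping.keys f. \<Sum>i<m. Poly_Mapping.single i (a ^ (m - Suc i) * coef f m))" .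
qed

text \<open>
  For a monomial \<open>z\<^sup>m\<close> the quotient by \<open>z - a\<close> is \<open>\<Sum> z\<^sup>i a\<^sup>m\<^sup>-\<^sup>1\<^sup>-\<^sup>i\<close> and its action is the geometric
  sum of \<open>geometric_sum_inner_deriv\<close>; central coefficients can be moved past \<open>a\<close> and \<open>c\<close>.
\<close>

lemma rval_Lquot_taylor:
  fixes a b c :: "'a::division_ring"
  assumes f: "central_poly f"
  shows "rval (Lquot a f * cnst c) b
    = (\<Sum>j<zdeg f. (inner_deriv a b ^^ j) c * hasse_value (Suc j) f b)"
proof -
  define D where "D j = (inner_deriv a b ^^ j) c" for j
  have comm: "coef f m * x = x * coef f m" for m x
    using f center_comm unfolding central_poly_def by blast
  have comm_nat: "of_nat r * (x * y) = x * (of_nat r * y)" for r and x y :: 'a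
    by (metis mult.assoc mult_of_nat_commute)
  have le: "m \<le> zdeg f" if "m \<in> Poly_Mapping.keys f" for m
    using that polys_below_self[of f] by (auto simp: polys_below_iff in_keys_iff not_less_eq_eq)
  have "rval (Lquot a f * cnst c) b
      = (\<Sum>m\<in>Poly_Mapping.keys f. \<Sum>i<m. a ^ (m - Suc i) * coef f m * c * b ^ i)"
    by (simp add: Lquot_eq sum_distrib_right rval_sum mult_single)
  also have "\<dots> = (\<Sum>m\<in>Poly_Mapping.keys f. (\<Sum>i<m. a ^ (m - Suc i) * c * b ^ i) * coef f m)"
    unfolding sum_distrib_right by (intro sum.cong refl) (metis comm mult.assoc)
  also have "\<dots> = (\<Sum>m\<in>Poly_Mapping.keys f. \<Sum>j<zdeg f.
      D j * (of_nat (m choose Suc j) * (b ^ (m - Suc j) * coef f m)))"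
  proof (rule sum.cong)
    fix m assume m: "m \<in> Poly_Mapping.keys f"
    have "(\<Sum>i<m. a ^ (m - Suc i) * c * b ^ i) * coef f m
        = (\<Sum>j<m. D j * (of_nat (m choose Suc j) * (b ^ (m - Suc j) * coef f m)))"
      unfolding geometric_sum_inner_deriv
      by (simp add: sum_distrib_right D_def comm_nat mult.assoc)
    also have "\<dots> = (\<Sum>j<zdeg f. D j * (of_nat (m choose Suc j) * (b ^ (m - Suc j) * coef f m)))"
      by (rule sum.mono_neutral_left) (use le[OF m] in \<open>auto simp: not_less binomial_eq_0\<close>)
    finally show "(\<Sum>i<m. a ^ (m - Suc i) * c * b ^ i) * coef f m
        = (\<Sum>j<zdeg f. D j * (of_nat (m choose Suc j) * (b ^ (m - Suc j) * coef f m)))" .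
  qed simp
  also have "\<dots> = (\<Sum>j<zdeg f. D j * hasse_value (Suc j) f b)"
    unfolding hasse_value_def sum_distrib_left by (rule sum.swap)
  finally show ?thesis by (simp add: D_def)
qed

lemma hasse_value_commute:
  assumes f: "central_poly f"
  shows "b * hasse_value j f b = hasse_value j f b * b"
proof -
  have "b * (of_nat r * (b ^ l * coef f m)) = of_nat r * (b ^ l * coef f m) * b" for r l m
  proof -
    have comm: "coef f m * b = b * coef f m"
      using f center_comm unfolding central_poly_def by blast
    have "b * (of_nat r * (b ^ l * coef f m)) = of_nat r * (b * (b ^ l * coef f m))"
      by (simp only: mult_of_nat_commute[of r b] flip: mult.assoc)
    also have "b * (b ^ l * coef f m) = b ^ l * (b * coef f m)"
      by (simp only: power_commutes flip: mult.assoc)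
    finally show ?thesis by (simp only: mult.assoc comm)
  qed
  then show ?thesis by (simp add: hasse_value_def sum_distrib_left sum_distrib_right)
qed

lemma center_of_nat: "of_nat r \<in> ring_center"
  unfolding ring_center_def using mult_of_nat_commute by blast

text \<open>
  The derivative is central with leading coefficient \<open>deg X \<noteq> 0\<close>; a zero at \<open>b\<close> would be a zero
  at \<open>a\<close>, against the minimality of \<open>X\<close>.
\<close>

lemma formal_deriv_minpoly_nonzero:
  fixes a b :: "'a::division_ring"
  assumes alg: "algebraic_over_center a" and ab: "conjugate a b"
    and char: "of_nat (fact (zdeg (center_minpoly a))) \<noteq> (0::'a)"
  shows "lval (formal_deriv (center_minpoly a)) b \<noteq> 0"
proof
  let ?X = "center_minpoly a"
  note X = center_minpoly_central[OF alg]
  obtain n where n: "zdeg ?X = Suc n" using Lquot_center_minpoly(4)[OF alg] by metis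
  have central: "central_poly (formal_deriv ?X)"
    using X unfolding central_poly_def coef_formal_deriv
    by (intro allI center_mult center_of_nat) blast
  have "coef (formal_deriv ?X) n = of_nat (Suc n)"
    using center_minpoly_monic[OF alg] n by (simp add: coef_formal_deriv monic_def)
  moreover have "of_nat (Suc n) \<noteq> (0::'a)"
    using char unfolding n by (simp only: fact_Suc of_nat_mult of_nat_id) simp
  ultimately have nz: "coef (formal_deriv ?X) n \<noteq> 0" by simp
  have "formal_deriv ?X \<in> polys_below (Suc n)"
    using polys_below_self[of ?X] n by (simp add: polys_below_iff coef_formal_deriv)
  then have deg: "zdeg (formal_deriv ?X) = n" by (rule zdeg_eqI[OF _ nz])
  assume b: "lval (formal_deriv ?X) b = 0"
  obtain k where k: "k \<noteq> 0" "a * k = k * b" using ab by (auto simp: conjugate_iff)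
  have "lval (formal_deriv ?X) a = 0"
    using central_intertwine[OF central k(2)] b k(1) by simp
  moreover have "formal_deriv ?X \<noteq> 0" using nz by auto
  ultimately have "zdeg ?X \<le> n"
    using zdeg_center_minpoly_le[OF alg central] deg by metis
  then show False using n by simp
qed

text \<open>
  Write \<open>\<delta>\<close> for \<open>x \<mapsto> a x - x b\<close> and \<open>H j\<close> for \<open>X\<^sup>(\<^sup>j\<^sup>)(b) / j!\<close>.  By the binomial
  theorem the inner sums of \<open>Psi\<close> are powers of \<open>\<delta>\<close>, and
  \<open>Psi a b c = - (\<Sum>j = 1..n. \<delta>\<^sup>j\<^sup>-\<^sup>1 c H (j + 1)) X'(b)\<^sup>-\<^sup>1\<close> with \<open>n = deg X - 1\<close>.  Applying \<open>\<delta>\<close>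
  raises its exponents by one, and the sum becomes the Taylor expansion of \<open>L\<close> acting on \<open>c\<close>, which
  is \<open>0\<close>, without its term \<open>c H 1 = c X'(b)\<close>.
\<close>

lemma sylvester_Psi_conjugate:
  fixes a b c :: "'a::division_ring"
  assumes alg: "algebraic_over_center a" and ab: "conjugate a b"
    and char: "of_nat (fact (zdeg (center_minpoly a))) \<noteq> (0::'a)"
    and c: "rval (Lquot a (center_minpoly a) * cnst c) b = 0"
  shows "a * Psi a b c - Psi a b c * b = c"
proof -
  define X where "X = center_minpoly a"
  define \<delta> where "\<delta> = inner_deriv a b"
  define H where "H j = hasse_value j X b" for j
  define v where "v = lval (formal_deriv X) b"
  obtain n where n: "zdeg X = Suc n"
    using Lquot_center_minpoly(4)[OF alg] unfolding X_def by metis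
  have X: "central_poly X" unfolding X_def by (rule center_minpoly_central[OF alg])
  have v: "v \<noteq> 0" unfolding v_def X_def by (rule formal_deriv_minpoly_nonzero[OF alg ab char])
  \<comment> \<open>The coefficient to be inverted in the Taylor expansion.\<close>
  have v_H: "v = H 1"
    using lval_formal_deriv_funpow[of 1 X b] by (simp add: v_def H_def)
  have H: "lval ((formal_deriv ^^ j) X) b = of_nat (fact j) * H j" for j
    by (simp add: lval_formal_deriv_funpow H_def)
  have bH: "b * H j = H j * b" for j
    unfolding H_def by (rule hasse_value_commute[OF X])
  have bv: "b * inverse v = inverse v * b"
    using bH[of 1] v unfolding v_H
    by (metis (no_types, lifting) mult.assoc left_inverse right_inverse mult_1 mult.right_neutral)
  have fact_nz: "of_nat (fact (j + 1)) \<noteq> (0::'a)" if "j \<in> {1..n}" for j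
  proof
    assume "of_nat (fact (j + 1)) = (0::'a)"
    moreover have "fact (j + 1) dvd (fact (Suc n) :: nat)"
      using that by (intro fact_dvd) simp
    ultimately have "of_nat (fact (Suc n)) = (0::'a)"
      by (metis dvd_def mult_zero_left of_nat_mult)
    with char[folded X_def, unfolded n] show False by (rule notE)
  qed
  have "Psi a b c = (\<Sum>j = 1..n. - ((\<delta> ^^ (j - 1)) c * H (j + 1) * inverse v))"
  proof -
    have "Psi a b c = (\<Sum>j = 1..n. \<Sum>i = 0..j - 1.
           ((- 1) ^ (i + j) / of_nat (fact (j + 1))) * of_nat ((j - 1) choose i)
           * a ^ i * c * (of_nat (fact (j + 1)) * H (j + 1)) * b ^ (j - i - 1)
           * inverse v)"
      using ab n unfolding Psi_def Let_def v_def X_def[symmetric] H by simp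
    also have "\<dots> = (\<Sum>j = 1..n. - ((\<delta> ^^ (j - 1)) c * H (j + 1) * inverse v))"
    proof (rule sum.cong)
      fix j assume j: "j \<in> {1..n}"
      define F where "F = (of_nat (fact (j + 1)) :: 'a)"
      have F: "F \<noteq> 0" unfolding F_def by (rule fact_nz[OF j])
      have Fc: "F * y = y * F" for y unfolding F_def by (rule mult_of_nat_commute)
      have iFc: "inverse F * y * F = y" for y
      proof -
        have "inverse F * y * F = inverse F * F * y" by (simp only: mult.assoc Fc[of y])
        also have "\<dots> = y" using F by simp
        finally show ?thesis .
      qed
      have bpow: "H (j + 1) * b ^ l = b ^ l * H (j + 1)" for l
        by (induction l) (simp_all add: mult.assoc, metis bH mult.assoc)
      have summand: "((- 1) ^ (i + j) / F) * of_nat ((j - 1) choose i)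
           * a ^ i * c * (F * H (j + 1)) * b ^ (j - i - 1) * inverse v
           = - ((- 1) ^ (i + (j - 1)) * of_nat ((j - 1) choose i) * (a ^ i * c * b ^ (j - 1 - i)))
             * (H (j + 1) * inverse v)" for i
      proof -
        define y where "y = of_nat ((j - 1) choose i) * (a ^ i * c)"
        have "((- 1) ^ (i + j) / F) * of_nat ((j - 1) choose i)
           * a ^ i * c * (F * H (j + 1)) * b ^ (j - i - 1) * inverse v
           = (- 1) ^ (i + j) * (inverse F * y * F) * (H (j + 1) * b ^ (j - i - 1)) * inverse v"
          by (simp add: y_def divide_inverse mult.assoc)
        also have "\<dots> = (- 1) ^ (i + j) * y * b ^ (j - i - 1) * (H (j + 1) * inverse v)"
          unfolding iFc bpow by (simp add: mult.assoc)
        also have "\<dots> = - ((- 1) ^ (i + (j - 1))) * y * b ^ (j - i - 1) * (H (j + 1) * inverse v)"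
          using j by (cases j) simp_all
        finally show ?thesis by (simp add: y_def mult.assoc)
      qed
      have "(\<Sum>i = 0..j - 1. ((- 1) ^ (i + j) / F) * of_nat ((j - 1) choose i)
           * a ^ i * c * (F * H (j + 1)) * b ^ (j - i - 1) * inverse v)
           = - ((\<delta> ^^ (j - 1)) c * (H (j + 1) * inverse v))"
        unfolding summand \<delta>_def funpow_inner_deriv
        by (simp add: sum_distrib_right sum_negf atMost_atLeast0)
      then show "(\<Sum>i = 0..j - 1. ((- 1) ^ (i + j) / of_nat (fact (j + 1))) * of_nat ((j - 1) choose i)
           * a ^ i * c * (of_nat (fact (j + 1)) * H (j + 1)) * b ^ (j - i - 1) * inverse v)
           = - ((\<delta> ^^ (j - 1)) c * H (j + 1) * inverse v)"
        unfolding F_def by (simp only: mult.assoc)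
    qed simp
    finally show ?thesis .
  qed
  then have "\<delta> (Psi a b c) = (\<Sum>j = 1..n. \<delta> (- ((\<delta> ^^ (j - 1)) c * H (j + 1) * inverse v)))"
    by (simp add: \<delta>_def inner_deriv_sum)
  also have "\<dots> = (\<Sum>j = 1..n. - ((\<delta> ^^ j) c * H (j + 1) * inverse v))"
  proof (rule sum.cong)
    fix j assume "j \<in> {1..n}"
    then obtain i where i: "j = Suc i" by (cases j) auto
    have neg: "\<delta> (- y) = - \<delta> y" for y by (simp add: \<delta>_def inner_deriv_def)
    show "\<delta> (- ((\<delta> ^^ (j - 1)) c * H (j + 1) * inverse v)) = - ((\<delta> ^^ j) c * H (j + 1) * inverse v)"
      unfolding neg i
      by (simp add: \<delta>_def inner_deriv_mult_right[OF bv] inner_deriv_mult_right[OF bH])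
  qed simp
  also have "\<dots> = - (\<Sum>j = 1..n. (\<delta> ^^ j) c * H (j + 1)) * inverse v"
    by (simp add: sum_negf sum_distrib_right)
  also have "(\<Sum>j = 1..n. (\<delta> ^^ j) c * H (j + 1)) = - (c * v)"
  proof -
    have "0 = (\<Sum>j<Suc n. (\<delta> ^^ j) c * H (Suc j))"
      using c rval_Lquot_taylor[OF X, of a c b] unfolding n \<delta>_def H_def by (simp add: X_def)
    also have "\<dots> = c * v + (\<Sum>j<n. (\<delta> ^^ Suc j) c * H (Suc (Suc j)))"
      unfolding sum.lessThan_Suc_shift v_H by simp
    also have "(\<Sum>j<n. (\<delta> ^^ Suc j) c * H (Suc (Suc j))) = (\<Sum>j = 1..n. (\<delta> ^^ j) c * H (j + 1))"
      by (rule sum.reindex_bij_witness[where i = "\<lambda>j. j - 1" and j = Suc]) auto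
    finally show ?thesis by (simp add: eq_neg_iff_add_eq_0 add.commute)
  qed
  finally have "\<delta> (Psi a b c) = c"
    using v by (simp add: mult.assoc)
  then show ?thesis by (simp add: \<delta>_def inner_deriv_def)
qed

abbreviation left_weight :: "'a::division_ring set \<Rightarrow> 'a \<Rightarrow> 'a" where
  "left_weight \<Lambda> a \<equiv> inverse (lval (left.minpoly (\<Lambda> - {a})) a)"

lemma left_lagrange_diff:
  "left.lagrange \<Lambda> (\<lambda>a. w a - w' a) = left.lagrange \<Lambda> w - left.lagrange \<Lambda> w'"
  unfolding left.lagrange_def by (simp only: right_diff_distrib single_diff sum_subtractf)

lemma lval_times_linear_factor: "lval (h * linear_factor b) a = a * lval h a - lval h a * b"
  using left_value_times[of h "linear_factor b" a]
  by (simp add: linear_factor_def right_diff_distrib mult_single lval_diff)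

section \<open>Two-sided interpolation\<close>

text \<open>
  The factorization \<open>P = p * (z - u a u\<^sup>-\<^sup>1)\<close>, with \<open>u\<close> the weight of \<open>a\<close>, turns the action on
  \<open>u x\<close> into that of \<open>p\<close> on \<open>u (x b - a x)\<close>; the sum over the nodes is a Lagrange interpolant.
\<close>

lemma minpoly_action_sum:
  fixes \<Lambda> :: "'a::division_ring set"
  assumes fin: "finite \<Lambda>" and indep: "zdeg (left.minpoly \<Lambda>) = card \<Lambda>"
  shows "rval (left.minpoly \<Lambda> * cnst (\<Sum>a\<in>\<Lambda>. left_weight \<Lambda> a * x a)) b
    = rval (left.lagrange \<Lambda> (\<lambda>a. x a * b - a * x a)) b"
proof -
  have step: "rval (left.minpoly \<Lambda> * cnst (left_weight \<Lambda> a * x a)) b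
      = rval (left.minpoly (\<Lambda> - {a}) * cnst (left_weight \<Lambda> a * (x a * b - a * x a))) b" if a: "a \<in> \<Lambda>" for a
  proof -
    define p where "p = left.minpoly (\<Lambda> - {a})"
    define v where "v = lval p a"
    have v: "v \<noteq> 0" unfolding v_def p_def by (rule left.E_minpoly_delete[OF fin indep a])
    have P: "left.minpoly \<Lambda> = p * linear_factor (inverse v * a * v)"
      unfolding v_def p_def by (rule left.minpoly_delete[OF fin indep a])
    have "rval (left.minpoly \<Lambda> * cnst (inverse v * x a)) b
        = rval (p * cnst (rval (linear_factor (inverse v * a * v) * cnst (inverse v * x a)) b)) b"
      unfolding P mult.assoc[of p] by (rule right_value_times)
    also have "rval (linear_factor (inverse v * a * v) * cnst (inverse v * x a)) b
        = inverse v * x a * b - inverse v * a * (v * inverse v) * x a"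
      by (simp only: rval_linear_times rval_single mult.assoc power_0 mult_1_right)
    also have "\<dots> = inverse v * (x a * b - a * x a)"
      using v by (simp add: right_diff_distrib mult.assoc)
    finally show ?thesis by (simp only: v_def p_def)
  qed
  show ?thesis
    unfolding left.lagrange_def cnst_sum sum_distrib_left rval_sum
    by (rule sum.cong) (simp_all add: step)
qed

text \<open>
  By the choice of \<open>x\<close> the interpolant in \<open>minpoly_action_sum\<close> is the one for the data \<open>d - c\<close>,
  and the interpolant of constant data is constant.  The latter requires at least one node.
\<close>

lemma minpoly_action_particular:
  fixes \<Lambda> :: "'a::division_ring set"
  assumes fin: "finite \<Lambda>" and indep: "zdeg (left.minpoly \<Lambda>) = card \<Lambda>" and ne: "\<Lambda> \<noteq> {}"
    and x: "\<And>a. a \<in> \<Lambda> \<Longrightarrow> a * x a - x a * b = c a - d"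
  shows "rval (left.minpoly \<Lambda> * cnst (\<Sum>a\<in>\<Lambda>. left_weight \<Lambda> a * x a)) b
    = d - rval (left.lagrange \<Lambda> c) b"
proof -
  have "left.lagrange \<Lambda> (\<lambda>a. x a * b - a * x a) = left.lagrange \<Lambda> (\<lambda>a. d - c a)"
    unfolding left.lagrange_def
  proof (rule sum.cong)
    fix a assume "a \<in> \<Lambda>"
    then have "x a * b - a * x a = d - c a"
      using arg_cong[OF x[of a], of uminus] by simp
    then show "left.minpoly (\<Lambda> - {a}) * cnst (left_weight \<Lambda> a * (x a * b - a * x a))
        = left.minpoly (\<Lambda> - {a}) * cnst (left_weight \<Lambda> a * (d - c a))" by (simp only:)
  qed simp
  also have "\<dots> = left.lagrange \<Lambda> (lval (cnst d)) - left.lagrange \<Lambda> c"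
  proof -
    have "lval (cnst d) = (\<lambda>_. d)" by (rule ext) simp
    then show ?thesis by (simp only: left_lagrange_diff)
  qed
  also have "left.lagrange \<Lambda> (lval (cnst d)) = cnst d"
    using fin ne by (intro left.lagrange_E[OF fin indep]) (simp add: polys_below_def card_gt_0_iff)
  finally show ?thesis
    by (simp add: minpoly_action_sum[OF fin indep] rval_diff)
qed

text \<open>
  If \<open>P * cnst g = h * (z - b)\<close>, then \<open>h\<close> has degree below the number of nodes, so that it is the
  interpolant of its left values.  These are intertwiners because the left-hand side vanishes at
  the nodes, and \<open>g\<close> is recovered from them as the coefficient of \<open>h\<close> of highest possible degree.
\<close>

lemma minpoly_action_kernel:
  fixes \<Lambda> :: "'a::division_ring set"
  assumes fin: "finite \<Lambda>" and indep: "zdeg (left.minpoly \<Lambda>) = card \<Lambda>" and ne: "\<Lambda> \<noteq> {}"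
    and g: "rval (left.minpoly \<Lambda> * cnst g) b = 0"
  shows "\<exists>\<phi>. (\<forall>a\<in>\<Lambda>. a * \<phi> a = \<phi> a * b) \<and> g = (\<Sum>a\<in>\<Lambda>. left_weight \<Lambda> a * \<phi> a)"
proof -
  let ?P = "left.minpoly \<Lambda>"
  obtain N where N: "card \<Lambda> = Suc N" using fin ne by (metis card_gt_0_iff gr0_implies_Suc)
  have P: "monic ?P" "?P \<in> left.vanishing \<Lambda>"
    using left.monic_minpoly[OF fin] left.minpoly_vanishing[OF fin] by blast+
  obtain h where h: "?P * cnst g = h * linear_factor b"
    using g rval_eq_0_iff by blast
  have Pg: "?P * cnst g \<in> polys_below (Suc (card \<Lambda>))"
    using polys_below_self[of ?P] by (simp add: indep polys_below_iff)
  have h_below: "h \<in> polys_below (Suc N)"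
  proof (cases "h = 0")
    case False
    then have "zdeg (h * linear_factor b) = Suc (zdeg h)" by (simp add: zdeg_times)
    moreover have "h * linear_factor b \<noteq> 0" using False by simp
    ultimately show ?thesis using Pg N by (auto simp: h polys_below_def)
  qed (simp add: polys_below_def)
  have intertwine: "a * lval h a = lval h a * b" if "a \<in> \<Lambda>" for a
  proof -
    have "lval (h * linear_factor b) a = 0"
      using P(2) that unfolding h[symmetric] by (simp add: left.vanishing_def)
    then show ?thesis by (simp add: lval_times_linear_factor)
  qed
  \<comment> \<open>Compare the coefficients of degree \<open>N + 1\<close>: \<open>P\<close> and all \<open>left.minpoly (\<Lambda> - {a})\<close> are monic.\<close>
  have "g = coef (?P * cnst g) (card \<Lambda>)"
    using P(1) by (simp add: monic_def indep)
  also have "\<dots> = coef h N"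
    unfolding h N using lead_coef_times[OF h_below linear_polys_below[of b]]
    by (simp add: coef_linear)
  also have "h = left.lagrange \<Lambda> (lval h)"
    using h_below N by (intro left.lagrange_E[OF fin indep, symmetric]) simp
  also have "coef \<dots> N = (\<Sum>a\<in>\<Lambda>. left_weight \<Lambda> a * lval h a)"
    unfolding left.lagrange_def lookup_sum
  proof (rule sum.cong)
    fix a assume a: "a \<in> \<Lambda>"
    have "monic (left.minpoly (\<Lambda> - {a}))" using fin by (intro left.monic_minpoly) simp
    then show "coef (left.minpoly (\<Lambda> - {a}) * cnst (left_weight \<Lambda> a * lval h a)) N = left_weight \<Lambda> a * lval h a"
      using left.zdeg_minpoly_delete[OF fin indep a] N by (simp add: monic_def)
  qed simp
  finally show ?thesis using intertwine by blast
qed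

lemma intertwiner_eq_0:
  "a * x = x * b \<Longrightarrow> \<not> conjugate a b \<Longrightarrow> x = 0" for a b x :: "'a::division_ring"
  unfolding conjugate_iff by blast

definition interpolates_on ::
  "'a::division_ring set \<Rightarrow> 'a set \<Rightarrow> ('a \<Rightarrow> 'a) \<Rightarrow> ('a \<Rightarrow> 'a) \<Rightarrow> 'a zpoly \<Rightarrow> bool" where
  "interpolates_on \<Lambda> \<Omega> c d f \<longleftrightarrow> (\<forall>a\<in>\<Lambda>. lval f a = c a) \<and> (\<forall>b\<in>\<Omega>. rval f b = d b)"

text \<open>
  If \<open>S a b\<close> solves \<open>a x - x b = c a - d b\<close> for all nodes, this polynomial has the left values \<open>c\<close>
  and the right values \<open>d\<close>; \<open>d\<close> enters only through \<open>S\<close>.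
\<close>

definition interpolant ::
  "'a::division_ring set \<Rightarrow> 'a set \<Rightarrow> ('a \<Rightarrow> 'a) \<Rightarrow> ('a \<Rightarrow> 'a \<Rightarrow> 'a) \<Rightarrow> 'a zpoly" where
  "interpolant \<Lambda> \<Omega> c S = left.lagrange \<Lambda> c
     + left.minpoly \<Lambda> * right.lagrange \<Omega> (\<lambda>b. \<Sum>a\<in>\<Lambda>. left_weight \<Lambda> a * S a b)"

locale two_sided =
  fixes \<Lambda> \<Omega> :: "'a::division_ring set"
  assumes finD: "finite \<Lambda>" and indepD: "zdeg (left.minpoly \<Lambda>) = card \<Lambda>" and neD: "\<Lambda> \<noteq> {}"
    and finO: "finite \<Omega>" and indepO: "zdeg (right.minpoly \<Omega>) = card \<Omega>"
begin

lemma interpolant_interpolates: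
  assumes S: "\<And>a b. a \<in> \<Lambda> \<Longrightarrow> b \<in> \<Omega> \<Longrightarrow> a * S a b - S a b * b = c a - d b"
  shows "interpolates_on \<Lambda> \<Omega> c d (interpolant \<Lambda> \<Omega> c S)"
  unfolding interpolates_on_def
proof (intro conjI ballI)
  fix a assume a: "a \<in> \<Lambda>"
  have "lval (left.minpoly \<Lambda>) a = 0"
    using left.minpoly_vanishing[OF finD] a by (simp add: left.vanishing_def)
  then show "lval (interpolant \<Lambda> \<Omega> c S) a = c a"
    using left.E_lagrange[OF finD indepD a, of c]
    by (simp add: interpolant_def lval_add left.E_M_eq_0)
next
  fix b assume b: "b \<in> \<Omega>"
  have "rval (left.minpoly \<Lambda> * cnst (\<Sum>a\<in>\<Lambda>. left_weight \<Lambda> a * S a b)) b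
      = d b - rval (left.lagrange \<Lambda> c) b"
    by (rule minpoly_action_particular[OF finD indepD neD]) (rule S[OF _ b])
  then show "rval (interpolant \<Lambda> \<Omega> c S) b = d b"
    unfolding interpolant_def rval_add
      right_value_times[of "left.minpoly \<Lambda>" "right.lagrange \<Omega> w" for w]
      right.E_lagrange[OF finO indepO b] by simp
qed

lemma interpolant_polys_below: "interpolant \<Lambda> \<Omega> c S \<in> polys_below (card \<Lambda> + card \<Omega>)"
  unfolding interpolant_def
proof (rule polys_below_add)
  show "left.lagrange \<Lambda> c \<in> polys_below (card \<Lambda> + card \<Omega>)"
    using left.lagrange_polys_below[OF finD indepD] by (rule polys_below_mono) simp
  have "left.minpoly \<Lambda> \<in> polys_below (Suc (card \<Lambda>))"
    using polys_below_self[of "left.minpoly \<Lambda>"] by (simp only: indepD)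
  then show "left.minpoly \<Lambda> * right.lagrange \<Omega> w \<in> polys_below (card \<Lambda> + card \<Omega>)" for w
    by (rule polys_below_times) (rule right.lagrange_polys_below[OF finO indepO])
qed

lemma interpolates_imp_interpolant:
  assumes S: "\<And>a b. a \<in> \<Lambda> \<Longrightarrow> b \<in> \<Omega> \<Longrightarrow> a * S a b - S a b * b = c a - d b"
    and f: "interpolates_on \<Lambda> \<Omega> c d f" "f \<in> polys_below (card \<Lambda> + card \<Omega>)"
  shows "\<exists>\<phi>. (\<forall>a\<in>\<Lambda>. \<forall>b\<in>\<Omega>. a * \<phi> a b = \<phi> a b * b) \<and> f = interpolant \<Lambda> \<Omega> c (\<lambda>a b. S a b + \<phi> a b)"
proof -
  let ?P = "left.minpoly \<Lambda>" and ?f0 = "left.lagrange \<Lambda> c"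
  let ?G = "\<lambda>b. \<Sum>a\<in>\<Lambda>. left_weight \<Lambda> a * S a b"
  have "f - ?f0 \<in> left.vanishing \<Lambda>"
    using f(1) left.E_lagrange[OF finD indepD, of _ c]
    by (simp add: left.vanishing_def interpolates_on_def lval_diff)
  then obtain g where g: "f - ?f0 = ?P * g"
    unfolding left.vanishing_eq[OF finD] by blast
  then have fg: "f = ?f0 + ?P * g" by (simp add: diff_eq_eq add.commute)
  have P0: "?P \<noteq> 0" using left.monic_minpoly[OF finD] monic_nonzero by blast
  have g_below: "g \<in> polys_below (card \<Omega>)"
  proof (cases "g = 0")
    case False
    have "f - ?f0 \<in> polys_below (card \<Lambda> + card \<Omega>)"
      using polys_below_diff[OF f(2) polys_below_mono[OF left.lagrange_polys_below[OF finD indepD]]]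
      by simp
    then show ?thesis
      unfolding g using P0 False by (auto simp: polys_below_def zdeg_times indepD)
  qed (simp add: polys_below_def)
  have kernel: "\<exists>\<phi>. (\<forall>a\<in>\<Lambda>. a * \<phi> a = \<phi> a * b) \<and> rval g b - ?G b = (\<Sum>a\<in>\<Lambda>. left_weight \<Lambda> a * \<phi> a)"
    if b: "b \<in> \<Omega>" for b
  proof (rule minpoly_action_kernel[OF finD indepD neD])
    have "rval f b = d b" using f(1) b by (simp add: interpolates_on_def)
    then have "rval (?P * cnst (rval g b)) b = d b - rval ?f0 b"
      unfolding fg rval_add right_value_times[of ?P g] by (simp add: eq_diff_eq add.commute)
    also have "\<dots> = rval (?P * cnst (?G b)) b"
      by (rule minpoly_action_particular[OF finD indepD neD, symmetric]) (rule S[OF _ b])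
    finally show "rval (?P * cnst (rval g b - ?G b)) b = 0"
      by (simp add: single_diff right_diff_distrib rval_diff)
  qed
  have "\<exists>\<phi>. \<forall>b\<in>\<Omega>. (\<forall>a\<in>\<Lambda>. a * \<phi> b a = \<phi> b a * b)
      \<and> rval g b - ?G b = (\<Sum>a\<in>\<Lambda>. left_weight \<Lambda> a * \<phi> b a)"
    by (intro bchoice ballI kernel)
  then obtain \<phi> where \<phi>: "\<And>a b. b \<in> \<Omega> \<Longrightarrow> a \<in> \<Lambda> \<Longrightarrow> a * \<phi> b a = \<phi> b a * b"
    and val: "\<And>b. b \<in> \<Omega> \<Longrightarrow> rval g b - ?G b = (\<Sum>a\<in>\<Lambda>. left_weight \<Lambda> a * \<phi> b a)"
    by blast
  have "g = right.lagrange \<Omega> (rval g)"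
    by (rule right.lagrange_E[OF finO indepO g_below, symmetric])
  also have "\<dots> = right.lagrange \<Omega> (\<lambda>b. \<Sum>a\<in>\<Lambda>. left_weight \<Lambda> a * (S a b + \<phi> b a))"
    unfolding right.lagrange_def
  proof (rule sum.cong)
    fix b assume "b \<in> \<Omega>"
    then have "rval g b = (\<Sum>a\<in>\<Lambda>. left_weight \<Lambda> a * (S a b + \<phi> b a))"
      using val[of b] by (simp add: distrib_left sum.distrib diff_eq_eq add.commute)
    then show "cnst (rval g b * inverse (rval (right.minpoly (\<Omega> - {b})) b)) * right.minpoly (\<Omega> - {b})
      = cnst ((\<Sum>a\<in>\<Lambda>. left_weight \<Lambda> a * (S a b + \<phi> b a)) * inverse (rval (right.minpoly (\<Omega> - {b})) b))
        * right.minpoly (\<Omega> - {b})" by (simp only:)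
  qed simp
  finally have "f = interpolant \<Lambda> \<Omega> c (\<lambda>a b. S a b + \<phi> b a)"
    unfolding fg interpolant_def by simp
  then show ?thesis using \<phi> by (intro exI[of _ "\<lambda>a b. \<phi> b a"]) simp
qed

lemma interpolates_set_eq:
  assumes S: "\<And>a b. a \<in> \<Lambda> \<Longrightarrow> b \<in> \<Omega> \<Longrightarrow> a * S a b - S a b * b = c a - d b"
  shows "{f \<in> polys_below (card \<Lambda> + card \<Omega>). interpolates_on \<Lambda> \<Omega> c d f}
    = {interpolant \<Lambda> \<Omega> c (\<lambda>a b. S a b + \<phi> a b) | \<phi>. \<forall>a\<in>\<Lambda>. \<forall>b\<in>\<Omega>. a * \<phi> a b = \<phi> a b * b}"
    (is "?L = ?R")
proof
  show "?L \<subseteq> ?R"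
  proof
    fix f assume "f \<in> ?L"
    then have "interpolates_on \<Lambda> \<Omega> c d f" "f \<in> polys_below (card \<Lambda> + card \<Omega>)" by simp_all
    from interpolates_imp_interpolant[OF S this] show "f \<in> ?R" by blast
  qed
  show "?R \<subseteq> ?L"
  proof
    fix f assume "f \<in> ?R"
    then obtain \<phi> where f: "f = interpolant \<Lambda> \<Omega> c (\<lambda>a b. S a b + \<phi> a b)"
      and \<phi>: "\<forall>a\<in>\<Lambda>. \<forall>b\<in>\<Omega>. a * \<phi> a b = \<phi> a b * b" by blast
    have "interpolates_on \<Lambda> \<Omega> c d f"
      unfolding f
    proof (rule interpolant_interpolates)
      fix a b assume ab: "a \<in> \<Lambda>" "b \<in> \<Omega>"
      then have "a * \<phi> a b = \<phi> a b * b" using \<phi> by blast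
      then show "a * (S a b + \<phi> a b) - (S a b + \<phi> a b) * b = c a - d b"
        using S[OF ab] by (simp add: distrib_left distrib_right)
    qed
    then show "f \<in> ?L" unfolding f using interpolant_polys_below by simp
  qed
qed

end

text \<open>
  Both sides are the right value of \<open>L * f\<close> at \<open>b\<close>: with \<open>f = lval f a + (z - a) s\<close> the product
  \<open>L (z - a) s = X s = s X\<close> has the root \<open>b\<close>.
\<close>

lemma interpolates_imp_consistent:
  fixes a b :: "'a::division_ring"
  assumes alg: "algebraic_over_center a" and ab: "conjugate a b"
  shows "rval (Lquot a (center_minpoly a) * cnst (lval f a)) b
    = rval (Lquot a (center_minpoly a) * cnst (rval f b)) b"
proof -
  let ?X = "center_minpoly a" and ?L = "Lquot a (center_minpoly a)"
  note X = center_minpoly_central[OF alg]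
  obtain s where s: "f = cnst (lval f a) + linear_factor a * s" using left_remainder by blast
  have "?L * f = ?L * (cnst (lval f a) + linear_factor a * s)"
    by (rule arg_cong[OF s])
  also have "\<dots> = ?L * cnst (lval f a) + ?X * s"
    by (simp only: distrib_left Lquot_center_minpoly(2)[OF alg] flip: mult.assoc)
  also have "?X * s = s * ?X" by (rule central_commute[OF X])
  finally have "rval (?L * f) b = rval (?L * cnst (lval f a) + s * ?X) b"
    by (rule arg_cong)
  also have "\<dots> = rval (?L * cnst (lval f a)) b"
  proof -
    have "rval ?X b = 0"
      using center_minpoly_root_iff_conjugate[OF alg] ab central_rval_eq_lval[OF X] by simp
    then show ?thesis by (simp only: rval_add right.E_M_eq_0 add_0_right)
  qed
  finally show ?thesis unfolding right_value_times[of ?L f b] by (rule sym)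
qed

text \<open>
  Translation from sums over the sets of nodes to sums over their indices, with the intertwiners
  split off; these vanish outside \<open>sim\<close>, so that their sum is restricted to \<open>sim\<close>.
\<close>

lemma interpolant_indexed:
  fixes \<alpha> :: "'i \<Rightarrow> 'a::division_ring" and \<beta> :: "'j \<Rightarrow> 'a"
  assumes inj: "inj_on \<alpha> I" "inj_on \<beta> J" and fin: "finite I" "finite J"
    and c: "\<And>i. i \<in> I \<Longrightarrow> c' (\<alpha> i) = c i"
    and S: "\<And>i j. i \<in> I \<Longrightarrow> j \<in> J \<Longrightarrow> S' (\<alpha> i) (\<beta> j) = S i j + \<phi> i j"
    and sim: "sim \<subseteq> I \<times> J" and \<phi>: "\<And>i j. i \<in> I \<Longrightarrow> j \<in> J \<Longrightarrow> (i, j) \<notin> sim \<Longrightarrow> \<phi> i j = 0"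
  defines "\<Lambda> \<equiv> \<alpha> ` I" and "\<Omega> \<equiv> \<beta> ` J"
  defines "p \<equiv> \<lambda>i. left.minpoly (\<Lambda> - {\<alpha> i})" and "q \<equiv> \<lambda>j. right.minpoly (\<Omega> - {\<beta> j})"
  defines "u \<equiv> \<lambda>i. inverse (lval (p i) (\<alpha> i))" and "v \<equiv> \<lambda>j. inverse (rval (q j) (\<beta> j))"
  shows "interpolant \<Lambda> \<Omega> c' S' = (\<Sum>i\<in>I. p i * cnst (u i * c i))
    + left.minpoly \<Lambda> * (\<Sum>i\<in>I. \<Sum>j\<in>J. cnst (u i * S i j * v j) * q j)
    + left.minpoly \<Lambda> * (\<Sum>(i, j)\<in>sim. cnst (u i * \<phi> i j * v j) * q j)"
proof -
  have left: "left.lagrange \<Lambda> c' = (\<Sum>i\<in>I. p i * cnst (u i * c i))"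
    unfolding left.lagrange_def \<Lambda>_def sum.reindex[OF inj(1)] o_def p_def u_def
    by (rule sum.cong) (simp_all only: c)
  have "right.lagrange \<Omega> (\<lambda>b. \<Sum>a\<in>\<Lambda>. left_weight \<Lambda> a * S' a b)
      = (\<Sum>j\<in>J. cnst ((\<Sum>i\<in>I. u i * S' (\<alpha> i) (\<beta> j)) * v j) * q j)"
    unfolding right.lagrange_def \<Omega>_def \<Lambda>_def sum.reindex[OF inj(1)] sum.reindex[OF inj(2)]
      o_def p_def q_def u_def v_def ..
  also have "\<dots> = (\<Sum>j\<in>J. \<Sum>i\<in>I. cnst (u i * S i j * v j) * q j + cnst (u i * \<phi> i j * v j) * q j)"
  proof (rule sum.cong)
    fix j assume j: "j \<in> J"
    have "(\<Sum>i\<in>I. u i * S' (\<alpha> i) (\<beta> j)) * v j = (\<Sum>i\<in>I. u i * S i j * v j + u i * \<phi> i j * v j)"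
      unfolding sum_distrib_right
      by (rule sum.cong) (simp_all only: S j distrib_left distrib_right)
    then show "cnst ((\<Sum>i\<in>I. u i * S' (\<alpha> i) (\<beta> j)) * v j) * q j
        = (\<Sum>i\<in>I. cnst (u i * S i j * v j) * q j + cnst (u i * \<phi> i j * v j) * q j)"
      by (simp only: cnst_sum sum_distrib_right single_add distrib_right)
  qed simp
  also have "\<dots> = (\<Sum>i\<in>I. \<Sum>j\<in>J. cnst (u i * S i j * v j) * q j)
      + (\<Sum>i\<in>I. \<Sum>j\<in>J. cnst (u i * \<phi> i j * v j) * q j)"
    unfolding sum.distrib[symmetric] by (rule sum.swap)
  also have "(\<Sum>i\<in>I. \<Sum>j\<in>J. cnst (u i * \<phi> i j * v j) * q j)
      = (\<Sum>(i, j)\<in>sim. cnst (u i * \<phi> i j * v j) * q j)"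
    unfolding sum.cartesian_product
    by (rule sum.mono_neutral_right) (use sim fin \<phi> in \<open>auto\<close>)
  finally show ?thesis
    by (simp only: interpolant_def left distrib_left add.assoc)
qed

lemma sylvester_solvable:
  fixes a b c d :: "'a::division_ring"
  assumes alg: "algebraic_over_center a"
    and consistent: "conjugate a b \<Longrightarrow> rval (Lquot a (center_minpoly a) * cnst c) b
      = rval (Lquot a (center_minpoly a) * cnst d) b"
  shows "\<exists>x. a * x - x * b = c - d"
    and "(conjugate a b \<Longrightarrow> of_nat (fact (zdeg (center_minpoly a))) \<noteq> (0::'a))
      \<Longrightarrow> a * Psi a b (c - d) - Psi a b (c - d) * b = c - d"
proof -
  have 0: "rval (Lquot a (center_minpoly a) * cnst (c - d)) b = 0" if "conjugate a b"
    using consistent[OF that] by (simp only: single_diff right_diff_distrib rval_diff) simp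
  show "\<exists>x. a * x - x * b = c - d"
  proof (cases "conjugate a b")
    case True
    then show ?thesis by (intro sylvester_conjugate[OF alg] 0)
  next
    case False
    then show ?thesis by (intro exI[of _ "Psi a b (c - d)"] sylvester_not_conjugate[OF alg])
  qed
  show "a * Psi a b (c - d) - Psi a b (c - d) * b = c - d"
    if "conjugate a b \<Longrightarrow> of_nat (fact (zdeg (center_minpoly a))) \<noteq> (0::'a)"
  proof (cases "conjugate a b")
    case True
    then show ?thesis by (intro sylvester_Psi_conjugate[OF alg _ that] 0)
  next
    case False
    then show ?thesis by (rule sylvester_not_conjugate[OF alg])
  qed
qed

theorem theorem3p9:
  fixes \<alpha> \<beta> c d :: "nat \<Rightarrow> 'a::division_ring" and n k :: nat
  assumes n: "n \<ge> 1"
    and \<alpha>_distinct: "inj_on \<alpha> {1..n}"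
    and \<alpha>_indep: "left_P_independent (\<alpha> ` {1..n})"
    and \<alpha>_algebraic: "\<And>i. i \<in> {1..n} \<Longrightarrow> algebraic_over_center (\<alpha> i)"
    and \<beta>_distinct: "inj_on \<beta> {1..k}"
    and \<beta>_indep: "right_P_independent (\<beta> ` {1..k})"
  shows
    "let \<Lambda> = \<alpha> ` {1..n};
         \<Omega> = \<beta> ` {1..k};
         X = (\<lambda>i. center_minpoly (\<alpha> i));
         P = left_minpoly \<Lambda>;
         p = (\<lambda>i. left_minpoly (\<Lambda> - {\<alpha> i}));
         q = (\<lambda>j. right_minpoly (\<Omega> - {\<beta> j}));
         u = (\<lambda>i. inverse (lval (p i) (\<alpha> i)));
         v = (\<lambda>j. inverse (rval (q j) (\<beta> j)));
         sim = {(i, j). i \<in> {1..n} \<and> j \<in> {1..k} \<and> conjugate (\<alpha> i) (\<beta> j)};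
         interpolates = (\<lambda>f. (\<forall>i\<in>{1..n}. lval f (\<alpha> i) = c i) \<and>
                             (\<forall>j\<in>{1..k}. rval f (\<beta> j) = d j))
     in
       ((\<exists>f. interpolates f) \<longleftrightarrow>
          (\<forall>(i, j)\<in>sim. rval (Lquot (\<alpha> i) (X i) * cnst (c i)) (\<beta> j)
                       = rval (Lquot (\<alpha> i) (X i) * cnst (d j)) (\<beta> j))) \<and>
       ((\<exists>f. interpolates f) \<longrightarrow>
        (\<forall>(i, j)\<in>sim. of_nat (fact (zdeg (X i))) \<noteq> (0::'a)) \<longrightarrow>
          {f \<in> polys_below (n + k). interpolates f} =
          {(\<Sum>i = 1..n. p i * cnst (u i * c i))
           + P * (\<Sum>i = 1..n. \<Sum>j = 1..k. cnst (u i * Psi (\<alpha> i) (\<beta> j) (c i - d j) * v j) * q j)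
           + P * (\<Sum>(i, j)\<in>sim. cnst (u i * \<phi> i j * v j) * q j)
           | \<phi>. \<forall>(i, j)\<in>sim. \<alpha> i * \<phi> i j = \<phi> i j * \<beta> j})"

proof -
  define \<Lambda> where "\<Lambda> = \<alpha> ` {1..n}"
  define \<Omega> where "\<Omega> = \<beta> ` {1..k}"
  define ia where "ia = the_inv_into {1..n} \<alpha>"
  define ib where "ib = the_inv_into {1..k} \<beta>"
  define c' where "c' = (\<lambda>a. c (ia a))"
  define d' where "d' = (\<lambda>b. d (ib b))"
  define sim where "sim = {(i, j). i \<in> {1..n} \<and> j \<in> {1..k} \<and> conjugate (\<alpha> i) (\<beta> j)}"
  let ?int = "\<lambda>f. (\<forall>i\<in>{1..n}. lval f (\<alpha> i) = c i) \<and> (\<forall>j\<in>{1..k}. rval f (\<beta> j) = d j)"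
  let ?cons = "\<forall>(i, j)\<in>sim.
    rval (Lquot (\<alpha> i) (center_minpoly (\<alpha> i)) * cnst (c i)) (\<beta> j)
      = rval (Lquot (\<alpha> i) (center_minpoly (\<alpha> i)) * cnst (d j)) (\<beta> j)"
  have card: "card \<Lambda> = n" "card \<Omega> = k"
    unfolding \<Lambda>_def \<Omega>_def using \<alpha>_distinct \<beta>_distinct by (simp_all add: card_image)
  interpret two_sided \<Lambda> \<Omega>
    using \<alpha>_indep \<beta>_indep n
    by unfold_locales
       (simp_all add: left_P_independent_def right_P_independent_def left_minpoly_eq
          right_minpoly_eq \<Lambda>_def \<Omega>_def)
  have ia: "ia (\<alpha> i) = i" if "i \<in> {1..n}" for i
    unfolding ia_def by (rule the_inv_into_f_f[OF \<alpha>_distinct that])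
  have ib: "ib (\<beta> j) = j" if "j \<in> {1..k}" for j
    unfolding ib_def by (rule the_inv_into_f_f[OF \<beta>_distinct that])
  have int: "interpolates_on \<Lambda> \<Omega> c' d' f \<longleftrightarrow> ?int f" for f
    unfolding interpolates_on_def \<Lambda>_def \<Omega>_def c'_def d'_def ball_simps(9)
    by (intro arg_cong2[where f = "(\<and>)"] ball_cong refl) (simp_all only: ia ib)
  have sim_iff: "(i, j) \<in> sim \<longleftrightarrow> conjugate (\<alpha> i) (\<beta> j)" if "i \<in> {1..n}" "j \<in> {1..k}" for i j
    using that by (simp add: sim_def)
  have lift: "a * S (ia a) (ib b) - S (ia a) (ib b) * b = c' a - d' b"
    if S: "\<And>i j. i \<in> {1..n} \<Longrightarrow> j \<in> {1..k} \<Longrightarrow> \<alpha> i * S i j - S i j * \<beta> j = c i - d j"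
      and ab: "a \<in> \<Lambda>" "b \<in> \<Omega>" for S a b
  proof -
    obtain i j where ij: "a = \<alpha> i" "i \<in> {1..n}" "b = \<beta> j" "j \<in> {1..k}"
      using ab unfolding \<Lambda>_def \<Omega>_def by blast
    show ?thesis
      unfolding c'_def d'_def ij(1,3) ia[OF ij(2)] ib[OF ij(4)] by (rule S[OF ij(2,4)])
  qed
  have consistent: ?cons if f: "?int f" for f
  proof (intro ballI, clarify)
    fix i j assume "(i, j) \<in> sim"
    then have ij: "i \<in> {1..n}" "j \<in> {1..k}" "conjugate (\<alpha> i) (\<beta> j)" by (simp_all add: sim_def)
    show "rval (Lquot (\<alpha> i) (center_minpoly (\<alpha> i)) * cnst (c i)) (\<beta> j)
      = rval (Lquot (\<alpha> i) (center_minpoly (\<alpha> i)) * cnst (d j)) (\<beta> j)"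
      using interpolates_imp_consistent[OF \<alpha>_algebraic[OF ij(1)] ij(3), of f] f ij(1,2) by simp
  qed
  have cons_ij: "rval (Lquot (\<alpha> i) (center_minpoly (\<alpha> i)) * cnst (c i)) (\<beta> j)
      = rval (Lquot (\<alpha> i) (center_minpoly (\<alpha> i)) * cnst (d j)) (\<beta> j)"
    if "?cons" "i \<in> {1..n}" "j \<in> {1..k}" "conjugate (\<alpha> i) (\<beta> j)" for i j
    using that(1) sim_iff[OF that(2,3)] that(4) by blast
  have ex_iff: "(\<exists>f. ?int f) \<longleftrightarrow> ?cons"
  proof
    assume "\<exists>f. ?int f"
    then obtain f where "?int f" ..
    then show ?cons by (rule consistent)
  next
    assume cons: ?cons
    \<comment> \<open>Not \<open>Psi\<close>, whose defining formula may divide by zero here for conjugate nodes.\<close>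
    define S where "S i j = (SOME x. \<alpha> i * x - x * \<beta> j = c i - d j)" for i j
    have S: "\<alpha> i * S i j - S i j * \<beta> j = c i - d j" if "i \<in> {1..n}" "j \<in> {1..k}" for i j
      unfolding S_def
      by (rule someI_ex, rule sylvester_solvable(1)[OF \<alpha>_algebraic[OF that(1)]])
         (rule cons_ij[OF cons that])
    show "\<exists>f. ?int f"
      using interpolant_interpolates[OF lift[OF S]] unfolding int by blast
  qed
  let ?p = "\<lambda>i. left.minpoly (\<Lambda> - {\<alpha> i})" and ?q = "\<lambda>j. right.minpoly (\<Omega> - {\<beta> j})"
  let ?u = "\<lambda>i. inverse (lval (?p i) (\<alpha> i))" and ?v = "\<lambda>j. inverse (rval (?q j) (\<beta> j))"
  let ?F = "\<lambda>\<phi>. (\<Sum>i = 1..n. ?p i * cnst (?u i * c i))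
    + left.minpoly \<Lambda> * (\<Sum>i = 1..n. \<Sum>j = 1..k.
        cnst (?u i * Psi (\<alpha> i) (\<beta> j) (c i - d j) * ?v j) * ?q j)
    + left.minpoly \<Lambda> * (\<Sum>(i, j)\<in>sim. cnst (?u i * \<phi> i j * ?v j) * ?q j)"
  have formula: "{f \<in> polys_below (n + k). ?int f}
      = {?F \<phi> | \<phi>. \<forall>(i, j)\<in>sim. \<alpha> i * \<phi> i j = \<phi> i j * \<beta> j}"
    if ex: "\<exists>f. ?int f" and char: "\<forall>(i, j)\<in>sim. of_nat (fact (zdeg (center_minpoly (\<alpha> i)))) \<noteq> (0::'a)"
  proof -
    define S where "S i j = Psi (\<alpha> i) (\<beta> j) (c i - d j)" for i j
    define S' where "S' a b = S (ia a) (ib b)" for a b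
    have cons: ?cons using ex ex_iff by (simp only:)
    have S: "\<alpha> i * S i j - S i j * \<beta> j = c i - d j" if "i \<in> {1..n}" "j \<in> {1..k}" for i j
      unfolding S_def
    proof (rule sylvester_solvable(2)[OF \<alpha>_algebraic[OF that(1)] cons_ij[OF cons that]])
      show "of_nat (fact (zdeg (center_minpoly (\<alpha> i)))) \<noteq> (0::'a)" if "conjugate (\<alpha> i) (\<beta> j)"
        using char that sim_iff[OF \<open>i \<in> _\<close> \<open>j \<in> _\<close>] by blast
    qed
    have S': "a * S' a b - S' a b * b = c' a - d' b" if "a \<in> \<Lambda>" "b \<in> \<Omega>" for a b
      unfolding S'_def by (rule lift[OF S that])
    have expand: "interpolant \<Lambda> \<Omega> c' (\<lambda>a b. S' a b + \<psi> a b) = ?F \<phi>"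
      if \<phi>: "\<And>i j. (i, j) \<in> sim \<Longrightarrow> \<phi> i j = \<psi> (\<alpha> i) (\<beta> j)"
        and \<psi>: "\<And>i j. i \<in> {1..n} \<Longrightarrow> j \<in> {1..k} \<Longrightarrow> (i, j) \<notin> sim \<Longrightarrow> \<psi> (\<alpha> i) (\<beta> j) = 0" for \<phi> \<psi>
    proof -
      have "interpolant \<Lambda> \<Omega> c' (\<lambda>a b. S' a b + \<psi> a b) = ?F (\<lambda>i j. \<psi> (\<alpha> i) (\<beta> j))"
        unfolding \<Lambda>_def \<Omega>_def S_def[symmetric]
        by (rule interpolant_indexed[OF \<alpha>_distinct \<beta>_distinct finite_atLeastAtMost finite_atLeastAtMost])
           (use \<psi> in \<open>auto simp: c'_def S'_def ia ib sim_def\<close>)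
      also have "(\<Sum>(i, j)\<in>sim. cnst (?u i * \<psi> (\<alpha> i) (\<beta> j) * ?v j) * ?q j)
          = (\<Sum>(i, j)\<in>sim. cnst (?u i * \<phi> i j * ?v j) * ?q j)"
        by (rule sum.cong) (use \<phi> in auto)
      finally show ?thesis .
    qed
    have "{f \<in> polys_below (n + k). ?int f}
        = {interpolant \<Lambda> \<Omega> c' (\<lambda>a b. S' a b + \<psi> a b) | \<psi>. \<forall>a\<in>\<Lambda>. \<forall>b\<in>\<Omega>. a * \<psi> a b = \<psi> a b * b}"
      using interpolates_set_eq[OF S'] unfolding int card .
    also have "\<dots> = {?F \<phi> | \<phi>. \<forall>(i, j)\<in>sim. \<alpha> i * \<phi> i j = \<phi> i j * \<beta> j}" (is "?A = ?B")
    proof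
      show "?A \<subseteq> ?B"
      proof
        fix f assume "f \<in> ?A"
        then obtain \<psi> where f: "f = interpolant \<Lambda> \<Omega> c' (\<lambda>a b. S' a b + \<psi> a b)"
          and \<psi>: "\<forall>a\<in>\<Lambda>. \<forall>b\<in>\<Omega>. a * \<psi> a b = \<psi> a b * b" by blast
        have \<psi>': "\<alpha> i * \<psi> (\<alpha> i) (\<beta> j) = \<psi> (\<alpha> i) (\<beta> j) * \<beta> j" if "i \<in> {1..n}" "j \<in> {1..k}" for i j
          using \<psi> that unfolding \<Lambda>_def \<Omega>_def by blast
        have "f = ?F (\<lambda>i j. \<psi> (\<alpha> i) (\<beta> j))"
          unfolding f
        proof (rule expand)
          fix i j assume "i \<in> {1..n}" "j \<in> {1..k}" "(i, j) \<notin> sim"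
          then show "\<psi> (\<alpha> i) (\<beta> j) = 0"
            using intertwiner_eq_0[OF \<psi>'] sim_iff by blast
        qed simp
        moreover have "\<forall>(i, j)\<in>sim. \<alpha> i * \<psi> (\<alpha> i) (\<beta> j) = \<psi> (\<alpha> i) (\<beta> j) * \<beta> j"
          using \<psi>' unfolding sim_def by blast
        ultimately show "f \<in> ?B"
          by (intro CollectI exI[of _ "\<lambda>i j. \<psi> (\<alpha> i) (\<beta> j)"] conjI)
      qed
      show "?B \<subseteq> ?A"
      proof
        fix f assume "f \<in> ?B"
        then obtain \<phi> where f: "f = ?F \<phi>"
          and \<phi>: "\<forall>(i, j)\<in>sim. \<alpha> i * \<phi> i j = \<phi> i j * \<beta> j" by blast
        define \<psi> where "\<psi> a b = (if (ia a, ib b) \<in> sim then \<phi> (ia a) (ib b) else 0)" for a b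
        have "interpolant \<Lambda> \<Omega> c' (\<lambda>a b. S' a b + \<psi> a b) = ?F \<phi>"
        proof (rule expand)
          fix i j assume ij: "(i, j) \<in> sim"
          then have "i \<in> {1..n}" "j \<in> {1..k}" by (simp_all add: sim_def)
          then show "\<phi> i j = \<psi> (\<alpha> i) (\<beta> j)" using ij by (simp only: \<psi>_def ia ib if_True)
        qed (simp only: \<psi>_def ia ib if_False)
        moreover have "a * \<psi> a b = \<psi> a b * b" if ab: "a \<in> \<Lambda>" "b \<in> \<Omega>" for a b
        proof -
          obtain i j where ij: "a = \<alpha> i" "i \<in> {1..n}" "b = \<beta> j" "j \<in> {1..k}"
            using ab unfolding \<Lambda>_def \<Omega>_def by blast
          show ?thesis
            unfolding \<psi>_def ij(1,3) ia[OF ij(2)] ib[OF ij(4)] using \<phi> by auto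
        qed
        ultimately show "f \<in> ?A" unfolding f by (intro CollectI exI[of _ \<psi>]) simp
      qed
    qed
    finally show ?thesis .
  qed
  show ?thesis
    unfolding Let_def left_minpoly_eq right_minpoly_eq sim_def[symmetric]
      \<Lambda>_def[symmetric] \<Omega>_def[symmetric]
    by (intro conjI impI ex_iff formula)
qed

end
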